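(* Let $N\ge2$. Let $d(s)$ be a real monic polynomial of degree $N$ with distinct zeros $\delta_1,\dots,\delta_N$ in the open left half plane, and $e(s)$ a real polynomial of degree at most $N-1$ coprime to $d$ (so $e/d\in\Sigma S_N$). Let $a(s)$ be a real monic polynomial of degree $N-1$, $b(s)$ a real polynomial and $q_0\in\mathbb{R}$ such that $b(s)=\bigl(e(s)a(s)-q_0a(-s)^2\bigr)/d(s)$ and $e(\delta_i)a(\delta_i)=a(-\delta_i)^2q_0$ for $i=1,\dots,N$. Put $x_i=q_0a(-\delta_i)$. Then: 1. $\displaystyle\Bigl\|\frac{e}{d}-\frac{b}{a}\Bigr\|_2^2=\sum_{i=1}^N\frac{x_i^3}{e(\delta_i)\,d'(\delta_i)\,d(-\delta_i)}$, where $d'$ is the derivative of $d$ and $\|\cdot\|_2$ is the $L_2$ norm on the imaginary axis; 2. if $a$ is Hurwitz, this $L_2$ norm coincides with the $H_2$ norm; 3. if $a$ is not Hurwitz, the squared $L_2$ norm computed in 1 is strictly greater than the global minimum of the function $f:\Sigma S_{N-1}\to[0,\infty)$, $f(\hat b/\hat a)=\|e/d-\hat b/\hat a\|_2^2$.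
   Context: For a rational function $t$ with finite integral, the $L_2$ norm is $\|t\|_2^2=\frac{1}{2\pi}\int_{-\infty}^\infty|t(i\omega)|^2d\omega$; on $H_2$ (strictly proper real rational functions with all poles in the open left half plane) it coincides with the $H_2$ norm. A polynomial is Hurwitz if all its zeros lie in the open left half plane. $\Sigma S_n$ denotes the set of real rational functions $\hat b/\hat a$ with $\hat a,\hat b$ real coprime, $\hat a$ monic Hurwitz of degree $n$, $\deg\hat b<n$. *)

theory Defs
  imports "HOL-Analysis.Analysis" "HOL-Computational_Algebra.Polynomial"
begin

definition cpoly :: "real poly \<Rightarrow> complex poly" where
  "cpoly p = map_poly complex_of_real p"

definition croots :: "real poly \<Rightarrow> complex set" where
  "croots p = {z. poly (cpoly p) z = 0}"

definition hurwitz :: "real poly \<Rightarrow> bool" where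
  "hurwitz p \<longleftrightarrow> (\<forall>z. poly (cpoly p) z = 0 \<longrightarrow> Re z < 0)"

definition negarg :: "real poly \<Rightarrow> real poly" where
  "negarg p = pcompose p [:0, -1:]"

definition rat_fun :: "real poly \<Rightarrow> real poly \<Rightarrow> complex \<Rightarrow> complex" where
  "rat_fun p q z = poly (cpoly p) z / poly (cpoly q) z"

definition L2_finite :: "(complex \<Rightarrow> complex) \<Rightarrow> bool" where
  "L2_finite t \<longleftrightarrow> integrable lborel (\<lambda>w::real. (cmod (t (\<i> * complex_of_real w)))\<^sup>2)"

definition L2_sq :: "(complex \<Rightarrow> complex) \<Rightarrow> real" where
  "L2_sq t = (\<integral>w. (cmod (t (\<i> * complex_of_real w)))\<^sup>2 \<partial>lborel) / (2 * pi)"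

definition H2_sq :: "(complex \<Rightarrow> complex) \<Rightarrow> real" where
  "H2_sq t = (SUP \<sigma>\<in>{0<..}. (\<integral>w. (cmod (t (complex_of_real \<sigma> + \<i> * complex_of_real w)))\<^sup>2 \<partial>lborel) / (2 * pi))"

definition in_H2 :: "(complex \<Rightarrow> complex) \<Rightarrow> bool" where
  "in_H2 t \<longleftrightarrow> (\<exists>p q. q \<noteq> 0 \<and> hurwitz q \<and> degree p < degree q \<and> finite {z. t z \<noteq> rat_fun p q z})"

text \<open>Sigma S_n, represented by pairs (numerator, denominator).\<close>
definition SigmaS :: "nat \<Rightarrow> (real poly \<times> real poly) set" where
  "SigmaS n = {(bh, ah). coprime ah bh \<and> lead_coeff ah = 1 \<and> degree ah = n \<and> hurwitz ah \<and> degree bh < n}"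

end

theory Submission
  imports
    Defs
    "HOL-Computational_Algebra.Computational_Algebra"
    "HOL-Computational_Algebra.Field_as_Ring"
    "HOL-Complex_Analysis.Complex_Analysis"
    "HOL-Probability.Sinc_Integral"
begin

text \<open>
  The error is \<open>e/d - b/a = q\<^sub>0 a(-s)\<^sup>2 / (d(s) a(s))\<close>, and \<open>\<bar>a(-s)\<bar> = \<bar>a(s)\<bar>\<close> on the imaginary axis, so
  its norm is that of \<open>q\<^sub>0 a/d\<close>. Expanding \<open>a/d\<close> in its simple poles and applying the reproducing
  property \<open>\<langle>f, 1/(s + \<lambda>)\<rangle> = f(\<lambda>)\<close>, a consequence of Cauchy's theorem on half discs, yields the formula.

  If \<open>a\<close> is Hurwitz, then \<open>\<bar>a(-s)\<bar> \<le> \<bar>a(s)\<bar>\<close> in the right half plane, so \<open>\<bar>q\<^sub>0 a/d\<bar>\<close> dominates the error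
  there, and the \<open>L\<^sub>2\<close> norms of \<open>a/d\<close> on vertical lines decrease to the right.

  If \<open>a\<close> is not Hurwitz, the imaginary zeros of \<open>a\<close> cancel in \<open>b/a\<close>. Replacing \<open>b/a\<close> by its stable part \<open>h\<close>
  removes an orthogonal antistable summand from the error and drops the order to at most \<open>N - 2\<close>.
  The remaining error \<open>E\<close> does not vanish at some \<open>\<lambda> > 0\<close>, so passing to \<open>h + 2\<lambda>E(\<lambda>)/(s + \<lambda>)\<close> lowers the squared norm by
  \<open>2\<lambda>E(\<lambda>)\<^sup>2\<close>. A small change of the numerator makes the resulting fraction coprime of order exactly \<open>N - 1\<close>.
\<close>

section \<open>Cauchy's theorem in the right half plane\<close>

text \<open>Analyticity on the closed half plane refers to a neighbourhood of it, so the imaginary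
  axis is covered. The bound holds near infinity in all directions, as it does for rational
  functions. On the axis, order 1 gives square integrability and order 2 integrability.\<close>

definition rhp_decay :: "nat \<Rightarrow> (complex \<Rightarrow> complex) \<Rightarrow> bool" where
  "rhp_decay k f \<longleftrightarrow> f analytic_on {s. 0 \<le> Re s} \<and> f \<in> O[at_infinity](\<lambda>s. 1 / s ^ k)"

lemma rhp_decay_add: "rhp_decay k f \<Longrightarrow> rhp_decay k g \<Longrightarrow> rhp_decay k (\<lambda>s. f s + g s)"
  unfolding rhp_decay_def by (auto intro: analytic_on_add sum_in_bigo)

lemma rhp_decay_diff: "rhp_decay k f \<Longrightarrow> rhp_decay k g \<Longrightarrow> rhp_decay k (\<lambda>s. f s - g s)"
  unfolding rhp_decay_def by (auto intro: analytic_on_diff sum_in_bigo)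

lemma rhp_decay_cmult: "rhp_decay k f \<Longrightarrow> rhp_decay k (\<lambda>s. c * f s)"
  unfolding rhp_decay_def by (auto intro: analytic_on_mult analytic_on_const)

lemma rhp_decay_zero: "rhp_decay k (\<lambda>s. 0)"
  unfolding rhp_decay_def by auto

lemma rhp_decay_sum:
  "(\<And>i. i \<in> I \<Longrightarrow> rhp_decay k (f i)) \<Longrightarrow> rhp_decay k (\<lambda>s. \<Sum>i\<in>I. f i s)"
  by (induction I rule: infinite_finite_induct) (auto intro: rhp_decay_zero rhp_decay_add)

lemma rhp_decay_mult:
  assumes "rhp_decay k f" "rhp_decay l g"
  shows "rhp_decay (k + l) (\<lambda>s. f s * g s)"
proof -
  have "(\<lambda>s. f s * g s) \<in> O[at_infinity](\<lambda>s. 1 / s ^ k * (1 / s ^ l))"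
    using assms unfolding rhp_decay_def by (intro landau_o.big.mult) auto
  then show ?thesis
    using assms unfolding rhp_decay_def by (auto simp: power_add intro: analytic_on_mult)
qed

text \<open>By leading terms \<open>p / q\<close> behaves like
  \<open>s ^ degree p / s ^ degree q\<close> at infinity. The zero polynomial is a separate
  alternative because its \<open>degree\<close> is 0 by convention.\<close>

lemma rhp_decay_poly_divide:
  fixes p q :: "complex poly"
  assumes q: "q \<noteq> 0" "\<And>s. 0 \<le> Re s \<Longrightarrow> poly q s \<noteq> 0" and deg: "p = 0 \<or> degree p + k \<le> degree q"
  shows "rhp_decay k (\<lambda>s. poly p s / poly q s)"
proof (cases "p = 0")
  case True
  then show ?thesis using rhp_decay_zero by simp
next
  case False
  let ?m = "degree p" and ?n = "degree q"
  have nz: "eventually (\<lambda>s::complex. 1 \<le> norm s) at_infinity"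
    by (auto simp: eventually_at_infinity)
  have "((\<lambda>s. (poly p s / s ^ ?m) / (poly q s / s ^ ?n)) \<longlongrightarrow> lead_coeff p / lead_coeff q) at_infinity"
    using q by (intro tendsto_divide poly_divide_tendsto_aux) auto
  then have "((\<lambda>s. (poly p s / poly q s) / (s ^ ?m / s ^ ?n)) \<longlongrightarrow> lead_coeff p / lead_coeff q) at_infinity"
    by (simp add: field_simps)
  then have "(\<lambda>s. poly p s / poly q s) \<in> O[at_infinity](\<lambda>s. s ^ ?m / s ^ ?n)"
    by (rule bigoI_tendsto) (rule eventually_mono[OF nz], auto)
  also have "(\<lambda>s. s ^ ?m / s ^ ?n) \<in> O[at_infinity](\<lambda>s::complex. 1 / s ^ k)"
  proof (rule bigoI[where c = 1], rule eventually_mono[OF nz])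
    fix s :: complex assume s: "1 \<le> norm s"
    have "norm s ^ ?m * norm s ^ k \<le> norm s ^ ?n"
      using deg False s by (auto simp: power_add[symmetric] intro!: power_increasing)
    moreover have "norm s > 0" using s by linarith
    ultimately show "norm (s ^ ?m / s ^ ?n) \<le> 1 * norm (1 / s ^ k)"
      by (simp add: norm_divide norm_power field_simps)
  qed
  finally have "(\<lambda>s. poly p s / poly q s) \<in> O[at_infinity](\<lambda>s. 1 / s ^ k)" .
  moreover have "(\<lambda>s. poly p s / poly q s) analytic_on {s. 0 \<le> Re s}"
    using q by (intro analytic_intros) (auto intro!: analytic_on_holomorphic[THEN iffD2] holomorphic_intros exI[of _ UNIV])
  ultimately show ?thesis by (simp add: rhp_decay_def)
qed

lemma rhp_decay_simple_pole:
  assumes "Re \<delta> < 0"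
  shows "rhp_decay 1 (\<lambda>s. 1 / (s - \<delta>))"
  using rhp_decay_poly_divide[of "[:-\<delta>, 1:]" "[:1:]" 1] assms by fastforce

lemma rhp_decay_continuous: "rhp_decay k f \<Longrightarrow> continuous_on {s. 0 \<le> Re s} f"
  unfolding rhp_decay_def by (auto intro: analytic_imp_holomorphic holomorphic_on_imp_continuous_on)

lemma rhp_decay_continuous_axis:
  "rhp_decay k f \<Longrightarrow> continuous_on UNIV (\<lambda>w::real. f (\<i> * of_real w))"
  by (rule continuous_on_compose2[OF rhp_decay_continuous]) (auto intro!: continuous_intros)

section \<open>Integrals along the imaginary axis\<close>

lemma integrable_inverse_1_plus_square_real: "integrable lborel (\<lambda>w::real. 1 / (1 + w\<^sup>2))"
  using integrable_inverse_1_plus_square by (simp add: set_integrable_def inverse_eq_divide)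

lemma integral_inverse_1_plus_square_real: "(\<integral>w. 1 / (1 + w\<^sup>2) \<partial>lborel) = pi"
  using LBINT_inverse_1_plus_square
  by (simp add: interval_lebesgue_integral_def set_lebesgue_integral_def inverse_eq_divide)

text \<open>An integrable majorant: continuity bounds \<open>f\<close> on a compact piece of the
  axis, the decay bounds it on the rest.\<close>

lemma rhp_decay_2_bound:
  assumes "rhp_decay 2 f"
  obtains C where "\<And>w::real. cmod (f (\<i> * of_real w)) \<le> C * (1 / (1 + w\<^sup>2))"
proof -
  obtain c where c: "c > 0" "eventually (\<lambda>s. cmod (f s) \<le> c * cmod (1 / s ^ 2)) at_infinity"
    using assms unfolding rhp_decay_def by (auto elim: landau_o.bigE)
  then obtain R0 where R0: "\<And>s. R0 \<le> cmod s \<Longrightarrow> cmod (f s) \<le> c * cmod (1 / s ^ 2)"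
    by (auto simp: eventually_at_infinity)
  define R where "R = max R0 1"
  have "compact ((\<lambda>w::real. f (\<i> * of_real w)) ` {-R..R})"
    by (intro compact_continuous_image continuous_on_subset[OF rhp_decay_continuous_axis[OF assms]]) auto
  then obtain M where M: "\<And>w. w \<in> {-R..R} \<Longrightarrow> cmod (f (\<i> * of_real w)) \<le> M"
    by (force dest!: compact_imp_bounded simp: bounded_iff)
  have "M \<ge> 0" using order_trans[OF norm_ge_zero M[of 0]] by (auto simp: R_def)
  \<comment> \<open>The constant adds up those of two ranges: for
    \<open>\<bar>w\<bar> \<le> R\<close> one has
    \<open>M \<le> M * (1 + R\<^sup>2) / (1 + w\<^sup>2)\<close>; otherwise \<open>R \<ge> 1\<close>
    gives \<open>w\<^sup>2 \<ge> 1\<close> and so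
    \<open>c / w\<^sup>2 \<le> 2 * c / (1 + w\<^sup>2)\<close>.\<close>
  have "cmod (f (\<i> * of_real w)) \<le> (M * (1 + R\<^sup>2) + 2 * c) * (1 / (1 + w\<^sup>2))" for w :: real
  proof (cases "w \<in> {-R..R}")
    case True
    then have "w\<^sup>2 \<le> R\<^sup>2" by (auto simp: abs_le_square_iff[symmetric])
    then have "M * (1 + w\<^sup>2) \<le> M * (1 + R\<^sup>2)" using \<open>M \<ge> 0\<close> by (intro mult_left_mono) auto
    then have "M * (1 + w\<^sup>2) \<le> M * (1 + R\<^sup>2) + 2 * c" using c(1) by linarith
    then have "M \<le> (M * (1 + R\<^sup>2) + 2 * c) / (1 + w\<^sup>2)"
      by (subst pos_le_divide_eq) (auto simp: add_pos_nonneg)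
    then show ?thesis using M[OF True] by simp
  next
    case False
    then have w: "\<bar>w\<bar> \<ge> R" "\<bar>w\<bar> \<ge> 1" by (auto simp: R_def)
    then have w2: "w\<^sup>2 \<ge> 1" using abs_le_square_iff[of 1 w] by auto
    have "cmod (f (\<i> * of_real w)) \<le> c * cmod (1 / (\<i> * of_real w) ^ 2)"
      using w(1) by (intro R0) (auto simp: norm_mult R_def)
    also have "\<dots> = c / w\<^sup>2" by (simp add: norm_divide norm_power norm_mult)
    also have "\<dots> = (2 * c) / (2 * w\<^sup>2)" by simp
    also have "\<dots> \<le> (2 * c) / (1 + w\<^sup>2)"
      using c(1) w2 by (intro divide_left_mono mult_pos_pos) linarith+
    also have "\<dots> \<le> (M * (1 + R\<^sup>2) + 2 * c) / (1 + w\<^sup>2)"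
      using \<open>M \<ge> 0\<close> by (intro divide_right_mono) auto
    finally show ?thesis by simp
  qed
  then show ?thesis using that by blast
qed

lemma rhp_decay_2_integrable:
  assumes "rhp_decay 2 f"
  shows "integrable lborel (\<lambda>w::real. f (\<i> * of_real w))"
proof -
  obtain C where C: "\<And>w::real. cmod (f (\<i> * of_real w)) \<le> C * (1 / (1 + w\<^sup>2))"
    using rhp_decay_2_bound[OF assms] by blast
  show ?thesis
  proof (rule Bochner_Integration.integrable_bound)
    show "integrable lborel (\<lambda>w. C * (1 / (1 + w\<^sup>2)))"
      using integrable_inverse_1_plus_square_real by (rule integrable_mult_right)
    show "(\<lambda>w. f (\<i> * of_real w)) \<in> borel_measurable lborel"
      using rhp_decay_continuous_axis[OF assms] by (simp add: borel_measurable_continuous_onI)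
    show "AE w in lborel. norm (f (\<i> * of_real w)) \<le> norm (C * (1 / (1 + w\<^sup>2)))"
      using order_trans[OF C abs_ge_self] by (intro AE_I2) (simp only: real_norm_def)
  qed
qed

text \<open>The segment of the axis between heights \<open>-R\<close> and \<open>R\<close> is closed
  by the half circle on the right. By Cauchy's theorem both paths carry the same integral, and the
  arc contributes at most \<open>c * pi / R\<close>, since \<open>f\<close> is bounded by
  \<open>c / R\<^sup>2\<close> there.\<close>

lemma rhp_decay_2_integral_eq_0:
  assumes f: "rhp_decay 2 f"
  shows "(\<integral>w. f (\<i> * complex_of_real w) \<partial>lborel) = 0"
proof -
  let ?g = "\<lambda>w::real. f (\<i> * of_real w)"
  have cont: "continuous_on {s. 0 \<le> Re s} f" by (rule rhp_decay_continuous[OF f])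
  have diff: "f field_differentiable at x" if "x \<in> interior {s. 0 \<le> Re s} - {}" for x
    using that f interior_subset unfolding rhp_decay_def
    by (meson DiffD1 analytic_on_imp_differentiable_at subsetD)
  obtain c where c: "c > 0" "eventually (\<lambda>s. cmod (f s) \<le> c * cmod (1 / s ^ 2)) at_infinity"
    using f unfolding rhp_decay_def by (auto elim: landau_o.bigE)
  then obtain R0 where R0: "\<And>s. R0 \<le> cmod s \<Longrightarrow> cmod (f s) \<le> c * cmod (1 / s ^ 2)"
    by (auto simp: eventually_at_infinity)
  have bound: "norm (integral {-R..R} ?g) \<le> c * pi / R" if R: "R \<ge> R0" "R > 0" for R
  proof -
    let ?arc = "part_circlepath 0 R (-(pi/2)) (pi/2)"
    let ?lin = "linepath (- \<i> * of_real R) (\<i> * of_real R)"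
    have ends: "pathstart ?arc = - \<i> * of_real R" "pathfinish ?arc = \<i> * of_real R"
      by (auto simp: complex_eq_iff Re_exp Im_exp)
    have arc: "path_image ?arc \<subseteq> {s. 0 \<le> Re s}"
    proof
      fix z assume "z \<in> path_image ?arc"
      then obtain x where "x \<in> {-(pi/2)..pi/2}" "z = of_real R * exp (\<i> * of_real x)"
        by (auto simp: path_image_part_circlepath)
      then show "z \<in> {s. 0 \<le> Re s}" using R cos_ge_zero[of x] by (auto simp: Re_exp)
    qed
    have lin: "path_image ?lin \<subseteq> {s. 0 \<le> Re s}"
      by (auto simp: closed_segment_def)
    have "path_image (?lin +++ reversepath ?arc) \<subseteq> path_image ?lin \<union> path_image ?arc"
      by (metis path_image_join_subset path_image_reversepath)
    with arc lin have sub: "path_image (?lin +++ reversepath ?arc) \<subseteq> {s. 0 \<le> Re s}" by blast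
    have "valid_path (?lin +++ reversepath ?arc)"
      by (rule valid_path_join) (simp_all only: pathfinish_linepath pathstart_reversepath ends
          valid_path_linepath valid_path_reversepath valid_path_part_circlepath)
    moreover have "pathfinish (?lin +++ reversepath ?arc) = pathstart (?lin +++ reversepath ?arc)"
      by (simp only: pathfinish_join pathstart_join pathfinish_reversepath pathstart_linepath ends)
    ultimately have "(f has_contour_integral 0) (?lin +++ reversepath ?arc)"
      using Cauchy_theorem_convex[OF cont _ finite.emptyI diff _ sub] by (simp add: convex_halfspace_Re_ge)
    moreover have ilin: "f contour_integrable_on ?lin"
      by (rule contour_integrable_continuous_linepath)
         (use continuous_on_subset[OF cont lin] in simp)
    moreover have iarc: "f contour_integrable_on ?arc"
      by (rule contour_integrable_continuous_part_circlepath[OF continuous_on_subset[OF cont arc]])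
    have "(f has_contour_integral contour_integral ?lin f + - contour_integral ?arc f)
        (?lin +++ reversepath ?arc)"
      by (intro has_contour_integral_join has_contour_integral_reversepath has_contour_integral_integral
          ilin iarc valid_path_linepath valid_path_part_circlepath valid_path_imp_reverse)
    ultimately have "contour_integral ?lin f = contour_integral ?arc f"
      using has_contour_integral_unique by fastforce
    moreover have "contour_integral ?lin f = \<i> * integral {-R..R} ?g"
      using contour_integral_linepath_same_Re[of "- \<i> * of_real R" 0 "\<i> * of_real R" "-R" R f] R
      by (simp add: Complex_eq)
    moreover have "norm (contour_integral ?arc f) \<le> (c / R\<^sup>2) * R * (pi/2 - (-(pi/2)))"
    proof (rule has_contour_integral_bound_part_circlepath)
      show "(f has_contour_integral contour_integral ?arc f) ?arc"
        using iarc by (rule has_contour_integral_integral)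
      fix x assume "x \<in> path_image ?arc"
      then have "cmod x = R" using R in_path_image_part_circlepath[of x 0 R] by auto
      then show "cmod (f x) \<le> c / R\<^sup>2"
        using R0[of x] R by (simp add: norm_divide norm_power)
    qed (use R c in auto)
    ultimately have "norm (integral {-R..R} ?g) \<le> (c / R\<^sup>2) * R * pi"
      by (simp add: norm_mult)
    then show ?thesis using R by (simp add: power2_eq_square)
  qed
  have int: "integrable lborel ?g" by (rule rhp_decay_2_integrable[OF f])
  \<comment> \<open>Dominated convergence links the truncated integrals of the contour argument with
    the Lebesgue integral over the whole line.\<close>
  have "(\<lambda>n. \<integral>w. indicator {-real n..real n} w *\<^sub>R ?g w \<partial>lborel) \<longlonglongrightarrow> (\<integral>w. ?g w \<partial>lborel)"
  proof (rule integral_dominated_convergence[where w = "\<lambda>w. norm (?g w)"])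
    show "AE w in lborel. (\<lambda>n. indicator {-real n..real n} w *\<^sub>R ?g w) \<longlonglongrightarrow> ?g w"
    proof (rule AE_I2, rule tendsto_eventually)
      fix w :: real
      obtain m where "\<bar>w\<bar> \<le> real m" using real_arch_simple by blast
      then show "\<forall>\<^sub>F n in sequentially. indicator {-real n..real n} w *\<^sub>R ?g w = ?g w"
        by (intro eventually_sequentiallyI[of m]) (auto simp: indicator_def)
    qed
  qed (use int in \<open>auto simp: indicator_def\<close>)
  moreover have "(\<integral>w. indicator {-real n..real n} w *\<^sub>R ?g w \<partial>lborel) = integral {-real n..real n} ?g" for n
    using set_borel_integral_eq_integral(2)[of "{-real n..real n}" ?g]
      integrable_mult_indicator[OF _ int, of "{-real n..real n}"]
    by (simp add: set_lebesgue_integral_def set_integrable_def)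
  ultimately have lim: "(\<lambda>n. integral {-real n..real n} ?g) \<longlonglongrightarrow> (\<integral>w. ?g w \<partial>lborel)" by simp
  have "(\<lambda>n. integral {-real n..real n} ?g) \<longlonglongrightarrow> 0"
  proof (rule Lim_null_comparison)
    obtain m where m: "R0 \<le> real m" using real_arch_simple by blast
    show "\<forall>\<^sub>F n in sequentially. norm (integral {-real n..real n} ?g) \<le> c * pi / real n"
      using m by (intro eventually_sequentiallyI[of "max m 1"] bound) auto
    show "(\<lambda>n. c * pi / real n) \<longlonglongrightarrow> 0"
      by (rule lim_const_over_n)
  qed
  then show ?thesis using lim LIMSEQ_unique by blast
qed

lemma rhp_decay_mult_integrable:
  assumes "rhp_decay 1 f" "rhp_decay 1 g"
  shows "integrable lborel (\<lambda>w. f (\<i> * complex_of_real w) * g (\<i> * complex_of_real w))"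
  using rhp_decay_2_integrable[of "\<lambda>s. f s * g s"] rhp_decay_mult[OF assms]
  by (simp add: numeral_2_eq_2)

text \<open>The conjugated product is in general not analytic, so \<open>rhp_decay_mult\<close> does
  not cover it; its modulus equals that of the plain product, which serves as majorant.\<close>

lemma rhp_decay_mult_cnj_integrable:
  assumes "rhp_decay 1 f" "rhp_decay 1 g"
  shows "integrable lborel (\<lambda>w. f (\<i> * complex_of_real w) * cnj (g (\<i> * complex_of_real w)))"
proof (rule Bochner_Integration.integrable_bound[OF rhp_decay_mult_integrable[OF assms]])
  have "continuous_on UNIV (\<lambda>w::real. f (\<i> * of_real w) * cnj (g (\<i> * of_real w)))"
    by (intro continuous_intros rhp_decay_continuous_axis[OF assms(1)] rhp_decay_continuous_axis[OF assms(2)])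
  then show "(\<lambda>w. f (\<i> * complex_of_real w) * cnj (g (\<i> * complex_of_real w))) \<in> borel_measurable lborel"
    by (simp add: borel_measurable_continuous_onI)
qed (simp add: norm_mult)

lemma rhp_decay_norm_sq_integrable:
  assumes "rhp_decay 1 f"
  shows "integrable lborel (\<lambda>w. (cmod (f (\<i> * complex_of_real w)))\<^sup>2)"
proof -
  have "integrable lborel (\<lambda>w. Re (f (\<i> * complex_of_real w) * cnj (f (\<i> * complex_of_real w))))"
    using rhp_decay_mult_cnj_integrable[OF assms assms] by (rule integrable_Re)
  then show ?thesis by (simp add: complex_mult_cnj cmod_power2)
qed

text \<open>On the axis \<open>1 / (\<beta> - s)\<close> is the conjugate of
  \<open>1 / (s + cnj \<beta>)\<close>, whose pole lies in the left half plane.\<close>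

lemma rhp_kernel_integrable:
  assumes "rhp_decay 1 f" "0 < Re \<beta>"
  shows "integrable lborel (\<lambda>w. f (\<i> * complex_of_real w) / (\<beta> - \<i> * complex_of_real w))"
  using rhp_decay_mult_cnj_integrable[OF assms(1) rhp_decay_simple_pole[of "- cnj \<beta>"]] assms(2) by simp

text \<open>Subtracting a multiple of a fixed function \<open>h\<close> leaves a function that vanishes at \<open>\<beta>\<close>,
  so that division by \<open>\<beta> - s\<close> produces an integrand to which the half-plane Cauchy theorem applies.\<close>

lemma rhp_decay_kernel_quotient:
  assumes f: "rhp_decay 1 f" and h: "rhp_decay 1 h" and \<beta>: "0 < Re \<beta>" and h1: "h \<beta> = 1"
  shows "(\<integral>w. f (\<i> * complex_of_real w) / (\<beta> - \<i> * complex_of_real w) \<partial>lborel) =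
      f \<beta> * (\<integral>w. h (\<i> * complex_of_real w) / (\<beta> - \<i> * complex_of_real w) \<partial>lborel)"
proof -
  note int = rhp_kernel_integrable[OF _ \<beta>]
  define g where "g = (\<lambda>s. f s - f \<beta> * h s)"
  have g: "rhp_decay 1 g"
    unfolding g_def using f h by (intro rhp_decay_diff rhp_decay_cmult)
  have g0: "g \<beta> = 0" by (simp add: g_def h1)
  \<comment> \<open>As \<open>g \<beta> = 0\<close>, this is \<open>g s / (s - \<beta>)\<close> with
    the removable singularity filled by the derivative.\<close>
  define G where "G = (\<lambda>s. if s = \<beta> then deriv g \<beta> else (g s - g \<beta>) / (s - \<beta>))"
  have ne: "\<i> * complex_of_real w \<noteq> \<beta>" for w using \<beta> by auto
  have "G analytic_on {s. 0 \<le> Re s}"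
  proof -
    obtain T where "open T" "{s. 0 \<le> Re s} \<subseteq> T" "g holomorphic_on T"
      using g unfolding rhp_decay_def analytic_on_holomorphic by blast
    then show ?thesis
      unfolding G_def analytic_on_holomorphic using pole_lemma_open by blast
  qed
  moreover have "G \<in> O[at_infinity](\<lambda>s. 1 / s ^ 2)"
  proof -
    have "eventually (\<lambda>s. cmod \<beta> + 1 \<le> cmod s) at_infinity"
      by (auto simp: eventually_at_infinity)
    then have "eventually (\<lambda>s. G s = g s * (1 / (s - \<beta>))) at_infinity"
      by eventually_elim (auto simp: G_def g0)
    then have "G \<in> \<Theta>[at_infinity](\<lambda>s. g s * (1 / (s - \<beta>)))"
      by (rule bigthetaI_cong)
    moreover have "(\<lambda>s. g s * (1 / (s - \<beta>))) \<in> O[at_infinity](\<lambda>s. 1 / s * (1 / s))"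
    proof (rule landau_o.big.mult)
      show "g \<in> O[at_infinity](\<lambda>s. 1 / s)" using g by (simp add: rhp_decay_def)
      \<comment> \<open>Beyond this radius \<open>s\<close> is nonzero and its distance from
        \<open>\<beta>\<close> is at least half its modulus.\<close>
      have "eventually (\<lambda>s. 2 * cmod \<beta> + 1 \<le> cmod s) at_infinity"
        by (auto simp: eventually_at_infinity)
      then have "eventually (\<lambda>s. cmod (1 / (s - \<beta>)) \<le> 2 * cmod (1 / s)) at_infinity"
      proof eventually_elim
        case (elim s)
        have "cmod s / 2 \<le> cmod (s - \<beta>)"
          using elim norm_triangle_ineq2[of s \<beta>] by linarith
        moreover have "0 < cmod s" using elim norm_ge_zero[of \<beta>] by linarith
        ultimately have "1 / cmod (s - \<beta>) \<le> 1 / (cmod s / 2)"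
          by (intro divide_left_mono mult_pos_pos) linarith+
        then show ?case by (simp add: norm_divide)
      qed
      then show "(\<lambda>s. 1 / (s - \<beta>)) \<in> O[at_infinity](\<lambda>s. 1 / s)"
        by (rule bigoI)
    qed
    ultimately have "G \<in> O[at_infinity](\<lambda>s. 1 / s * (1 / s))"
      by (metis landau_o.big.in_cong_bigtheta)
    then show ?thesis by (simp add: power2_eq_square)
  qed
  ultimately have G0: "(\<integral>w. G (\<i> * complex_of_real w) \<partial>lborel) = 0"
    by (intro rhp_decay_2_integral_eq_0) (simp add: rhp_decay_def)
  have Geq: "G (\<i> * complex_of_real w) =
      f \<beta> * (h (\<i> * complex_of_real w) / (\<beta> - \<i> * complex_of_real w)) -
      f (\<i> * complex_of_real w) / (\<beta> - \<i> * complex_of_real w)" for w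
  proof -
    have "G (\<i> * complex_of_real w) = g (\<i> * complex_of_real w) / (\<i> * complex_of_real w - \<beta>)"
      using ne[of w] by (simp add: G_def g0)
    then show ?thesis
      using ne[of w] by (simp add: g_def divide_simps) (simp add: algebra_simps)
  qed
  have "(\<integral>w. G (\<i> * complex_of_real w) \<partial>lborel) =
      f \<beta> * (\<integral>w. h (\<i> * complex_of_real w) / (\<beta> - \<i> * complex_of_real w) \<partial>lborel) -
      (\<integral>w. f (\<i> * complex_of_real w) / (\<beta> - \<i> * complex_of_real w) \<partial>lborel)"
    unfolding Geq Bochner_Integration.integral_diff[OF integrable_mult_right[OF int[OF h]] int[OF f]]
    by (simp only: integral_mult_right_zero)
  with G0 show "(\<integral>w. f (\<i> * complex_of_real w) / (\<beta> - \<i> * complex_of_real w) \<partial>lborel) =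
      f \<beta> * (\<integral>w. h (\<i> * complex_of_real w) / (\<beta> - \<i> * complex_of_real w) \<partial>lborel)"
    by simp
qed

text \<open>Supplies the constant that \<open>rhp_decay_kernel_quotient\<close> leaves open.
  Reflecting \<open>w\<close> exchanges the roles of the two factors: the function becomes
  \<open>1 / (s + \<beta>)\<close> and the evaluation point becomes 1, where an arctangent integral
  remains.\<close>

lemma integral_kernel_unit:
  fixes \<beta> :: complex
  assumes \<beta>: "0 < Re \<beta>"
  shows "(\<integral>w. 1 / (\<i> * complex_of_real w + 1) / (\<beta> - \<i> * complex_of_real w) \<partial>lborel) = 2 * pi / (1 + \<beta>)"
proof -
  have "(\<integral>w. 1 / (\<i> * complex_of_real w + 1) / (\<beta> - \<i> * complex_of_real w) \<partial>lborel) =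
        (\<integral>w. 1 / (\<i> * complex_of_real (-w) + 1) / (\<beta> - \<i> * complex_of_real (-w)) \<partial>lborel)"
    using lborel_integral_real_affine[of "-1" "\<lambda>w. 1 / (\<i> * complex_of_real w + 1) / (\<beta> - \<i> * complex_of_real w)" 0]
    by simp
  also have "\<dots> = (\<integral>w. 1 / (\<i> * complex_of_real w - (-\<beta>)) / (1 - \<i> * complex_of_real w) \<partial>lborel)"
    by (intro Bochner_Integration.integral_cong) (auto simp: field_simps)
  \<comment> \<open>The reference function is \<open>2 / (s + 1)\<close>, normalised to take the
    value 1 at the point 1.\<close>
  also have "\<dots> = 1 / (1 - (-\<beta>)) * (\<integral>w. 2 * (1 / (\<i> * complex_of_real w - (-1))) / (1 - \<i> * complex_of_real w) \<partial>lborel)"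
    using \<beta> by (intro rhp_decay_kernel_quotient rhp_decay_simple_pole rhp_decay_cmult) auto
  also have "(\<integral>w. 2 * (1 / (\<i> * complex_of_real w - (-1))) / (1 - \<i> * complex_of_real w) \<partial>lborel) =
      (\<integral>w. complex_of_real (2 * (1 / (1 + w\<^sup>2))) \<partial>lborel)"
  proof (intro Bochner_Integration.integral_cong refl)
    fix w :: real
    have "(\<i> * complex_of_real w - (-1)) * (1 - \<i> * complex_of_real w) = complex_of_real (1 + w\<^sup>2)"
      by (simp add: algebra_simps power2_eq_square)
    then show "2 * (1 / (\<i> * complex_of_real w - (-1))) / (1 - \<i> * complex_of_real w) =
        complex_of_real (2 * (1 / (1 + w\<^sup>2)))"
      by (simp add: divide_divide_eq_left)
  qed
  also have "\<dots> = complex_of_real (2 * pi)"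
    unfolding integral_complex_of_real integral_mult_right_zero integral_inverse_1_plus_square_real by simp
  finally show ?thesis by simp
qed

text \<open>Cauchy's formula for the half plane. The reference function
  \<open>(1 + \<beta>) / (s + 1)\<close> is 1 at \<open>\<beta>\<close>, and by
  \<open>integral_kernel_unit\<close> its kernel integral is \<open>2 * pi\<close>.\<close>

lemma rhp_reproducing_kernel:
  fixes f :: "complex \<Rightarrow> complex"
  assumes f: "rhp_decay 1 f" and \<beta>: "0 < Re \<beta>"
  shows "(\<integral>w. f (\<i> * complex_of_real w) / (\<beta> - \<i> * complex_of_real w) \<partial>lborel) = 2 * pi * f \<beta>"
proof -
  have ne: "1 + \<beta> \<noteq> 0" using \<beta> by (auto simp: complex_eq_iff)
  have "(\<integral>w. f (\<i> * complex_of_real w) / (\<beta> - \<i> * complex_of_real w) \<partial>lborel) =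
      f \<beta> * (\<integral>w. (1 + \<beta>) * (1 / (\<i> * complex_of_real w - (-1))) / (\<beta> - \<i> * complex_of_real w) \<partial>lborel)"
    by (rule rhp_decay_kernel_quotient[OF f _ \<beta>])
       (rule rhp_decay_cmult, rule rhp_decay_simple_pole, use ne in \<open>simp_all add: add.commute\<close>)
  also have "\<dots> = f \<beta> * ((1 + \<beta>) * (\<integral>w. 1 / (\<i> * complex_of_real w + 1) / (\<beta> - \<i> * complex_of_real w) \<partial>lborel))"
    by (subst integral_mult_right_zero[symmetric]) simp
  also have "\<dots> = 2 * pi * f \<beta>"
    unfolding integral_kernel_unit[OF \<beta>] using ne by simp
  finally show ?thesis .
qed

section \<open>Sums of simple poles\<close>

lemma integral_norm_sq_eq:
  "complex_of_real (\<integral>w. (cmod (f w))\<^sup>2 \<partial>M) = (\<integral>w. f w * cnj (f w) \<partial>M)"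
  unfolding integral_complex_of_real[symmetric] by (simp only: complex_norm_square)

lemma rhp_decay_pole_sum:
  assumes "\<And>i. i \<in> I \<Longrightarrow> Re (p i) < 0"
  shows "rhp_decay 1 (\<lambda>s. \<Sum>i\<in>I. r i / (s - p i))"
  using rhp_decay_sum[of I 1 "\<lambda>i s. r i * (1 / (s - p i))"]
    rhp_decay_cmult[OF rhp_decay_simple_pole] assms by simp

text \<open>On the axis the conjugate of \<open>1 / (s - p i)\<close> is the kernel at
  \<open>- cnj (p i)\<close>, the mirror image of the pole in the imaginary axis, so the reproducing
  property evaluates each summand.\<close>

lemma inner_product_pole_sum:
  assumes I: "finite I" "\<And>i. i \<in> I \<Longrightarrow> Re (p i) < 0" and g: "rhp_decay 1 g"
  shows "(\<integral>w. g (\<i> * complex_of_real w) * cnj (\<Sum>i\<in>I. r i / (\<i> * complex_of_real w - p i)) \<partial>lborel)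
    = 2 * pi * (\<Sum>i\<in>I. cnj (r i) * g (- cnj (p i)))"
proof -
  have \<beta>: "0 < Re (- cnj (p i))" if "i \<in> I" for i using I(2)[OF that] by simp
  have "(\<integral>w. g (\<i> * complex_of_real w) * cnj (\<Sum>i\<in>I. r i / (\<i> * complex_of_real w - p i)) \<partial>lborel)
    = (\<integral>w. (\<Sum>i\<in>I. cnj (r i) * (g (\<i> * complex_of_real w) / (- cnj (p i) - \<i> * complex_of_real w))) \<partial>lborel)"
    by (intro Bochner_Integration.integral_cong refl) (simp add: sum_distrib_left mult_ac minus_diff_commute)
  also have "\<dots> = (\<Sum>i\<in>I. \<integral>w. cnj (r i) * (g (\<i> * complex_of_real w) / (- cnj (p i) - \<i> * complex_of_real w)) \<partial>lborel)"
    using \<beta> by (intro Bochner_Integration.integral_sum integrable_mult_right rhp_kernel_integrable[OF g])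
  also have "\<dots> = (\<Sum>i\<in>I. cnj (r i) * (2 * pi * g (- cnj (p i))))"
    by (intro sum.cong refl) (simp only: integral_mult_right_zero rhp_reproducing_kernel[OF g \<beta>])
  finally show ?thesis by (simp add: sum_distrib_left mult_ac)
qed

text \<open>The double sums below are \<open>\<integral>\<^sub>0\<^sup>\<infinity> exp (-2\<sigma>t) \<bar>\<Sum>\<^sub>i r\<^sub>i exp (p\<^sub>i t)\<bar>\<^sup>2 dt\<close>; the function \<open>\<phi>\<close> is a primitive of
  \<open>(1 - exp (-2\<sigma>t)) \<bar>\<Sum>\<^sub>i r\<^sub>i exp (p\<^sub>i t)\<bar>\<^sup>2\<close>.\<close>

lemma cauchy_form_antimono:
  fixes p r :: "'i \<Rightarrow> complex" and \<sigma> :: real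
  assumes I: "finite I" "\<And>i. i \<in> I \<Longrightarrow> Re (p i) < 0" and \<sigma>: "0 \<le> \<sigma>"
  shows "Re (\<Sum>i\<in>I. \<Sum>j\<in>I. cnj (r i) * r j / (2 * \<sigma> - cnj (p i) - p j))
    \<le> Re (\<Sum>i\<in>I. \<Sum>j\<in>I. cnj (r i) * r j / (- cnj (p i) - p j))"
proof -
  define z where "z i j = cnj (p i) + p j" for i j
  have z: "Re (z i j) < 0" if "i \<in> I" "j \<in> I" for i j
    using I(2)[OF that(1)] I(2)[OF that(2)] by (simp add: z_def)
  have z0: "z i j \<noteq> 0" "z i j - 2 * \<sigma> \<noteq> 0" if "i \<in> I" "j \<in> I" for i j
    using z[OF that] \<sigma> by (auto simp: complex_eq_iff)
  define \<phi> where "\<phi> t = (\<Sum>i\<in>I. \<Sum>j\<in>I. cnj (r i) * r j *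
      (exp (of_real t * z i j) / z i j - exp (of_real t * (z i j - 2 * \<sigma>)) / (z i j - 2 * \<sigma>)))" for t :: real
  define h where "h t = (\<Sum>j\<in>I. r j * exp (of_real t * p j))" for t :: real
  have exp_deriv: "((\<lambda>t. exp (of_real t * c) / c) has_vector_derivative exp (of_real t * c)) (at t)"
    if "c \<noteq> 0" for c :: complex and t :: real
  proof -
    have "((\<lambda>s. exp (s * c) / c) has_field_derivative exp (of_real t * c)) (at (of_real t))"
      using that by (auto intro!: derivative_eq_intros)
    then show ?thesis by (rule has_vector_derivative_real_field)
  qed
  have deriv: "(\<phi> has_vector_derivative of_real ((1 - exp (- 2 * \<sigma> * t)) * (cmod (h t))\<^sup>2)) (at t)" for t
  proof -
    have "(\<phi> has_vector_derivative (\<Sum>i\<in>I. \<Sum>j\<in>I. cnj (r i) * r j *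
        (exp (of_real t * z i j) - exp (of_real t * (z i j - 2 * \<sigma>))))) (at t)"
      unfolding \<phi>_def
      by (intro has_vector_derivative_sum has_vector_derivative_mult_right has_vector_derivative_diff
          exp_deriv z0)
    also have "(\<Sum>i\<in>I. \<Sum>j\<in>I. cnj (r i) * r j * (exp (of_real t * z i j) - exp (of_real t * (z i j - 2 * \<sigma>))))
       = (\<Sum>i\<in>I. \<Sum>j\<in>I. of_real (1 - exp (- 2 * \<sigma> * t)) *
           (cnj (r i * exp (of_real t * p i)) * (r j * exp (of_real t * p j))))"
    proof (intro sum.cong refl)
      fix i j
      have "of_real t * z i j = cnj (of_real t * p i) + of_real t * p j"
        by (simp add: z_def algebra_simps)
      then have 1: "exp (of_real t * z i j) = cnj (exp (of_real t * p i)) * exp (of_real t * p j)"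
        by (simp only: exp_add exp_cnj)
      have "of_real t * (z i j - 2 * \<sigma>) = of_real t * z i j + of_real (- 2 * \<sigma> * t)"
        by (simp add: algebra_simps)
      then have 2: "exp (of_real t * (z i j - 2 * \<sigma>)) = exp (of_real t * z i j) * of_real (exp (- 2 * \<sigma> * t))"
        by (simp only: exp_add exp_of_real)
      show "cnj (r i) * r j * (exp (of_real t * z i j) - exp (of_real t * (z i j - 2 * \<sigma>))) =
          of_real (1 - exp (- 2 * \<sigma> * t)) * (cnj (r i * exp (of_real t * p i)) * (r j * exp (of_real t * p j)))"
        unfolding 2 unfolding 1 by (simp add: algebra_simps)
    qed
    \<comment> \<open>The double sum factors into \<open>cnj (h t)\<close> and \<open>h t\<close>,
      which exhibits the derivative as nonnegative.\<close>
    also have "\<dots> = of_real (1 - exp (- 2 * \<sigma> * t)) * (cnj (h t) * h t)"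
      unfolding h_def cnj_sum sum_product by (simp only: sum_distrib_left)
    also have "\<dots> = of_real ((1 - exp (- 2 * \<sigma> * t)) * (cmod (h t))\<^sup>2)"
      by (simp only: of_real_mult complex_norm_square mult.commute)
    finally show ?thesis .
  qed
  have mono: "Re (\<phi> 0) \<le> Re (\<phi> t)" if "0 \<le> t" for t
  proof (rule DERIV_nonneg_imp_nondecreasing[OF that])
    fix x assume x: "0 \<le> x" "x \<le> t"
    have "((\<lambda>t. Re (\<phi> t)) has_real_derivative (1 - exp (- 2 * \<sigma> * x)) * (cmod (h x))\<^sup>2) (at x)"
      using bounded_linear.has_vector_derivative[OF bounded_linear_Re deriv[of x]]
      by (simp add: has_real_derivative_iff_has_vector_derivative)
    moreover have "0 \<le> (1 - exp (- 2 * \<sigma> * x)) * (cmod (h x))\<^sup>2"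
      using \<sigma> x by (intro mult_nonneg_nonneg) auto
    ultimately show "\<exists>y. ((\<lambda>t. Re (\<phi> t)) has_real_derivative y) (at x) \<and> y \<ge> 0" by blast
  qed
  have dec: "((\<lambda>t. exp (of_real t * w)) \<longlongrightarrow> 0) at_top" if w: "Re w < 0" for w :: complex
  proof (rule tendsto_norm_zero_cancel)
    have "LIM t at_top. t * Re w :> at_bot"
      using w by (intro filterlim_tendsto_neg_mult_at_bot[OF tendsto_const _ filterlim_ident, THEN filterlim_cong[THEN iffD1, rotated -1]]) (auto simp: mult.commute)
    then have "((\<lambda>t. exp (t * Re w)) \<longlongrightarrow> 0) at_top"
      by (rule filterlim_compose[OF exp_at_bot])
    then show "((\<lambda>t. cmod (exp (of_real t * w))) \<longlongrightarrow> 0) at_top" by simp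
  qed
  have "(\<phi> \<longlongrightarrow> (\<Sum>i\<in>I. \<Sum>j\<in>I. cnj (r i) * r j * (0 / z i j - 0 / (z i j - 2 * \<sigma>)))) at_top"
    unfolding \<phi>_def
  proof (intro tendsto_intros dec)
    fix i j assume ij: "i \<in> I" "j \<in> I"
    show "Re (z i j) < 0" "z i j \<noteq> 0" "z i j - 2 * \<sigma> \<noteq> 0" using z z0 ij by auto
    show "Re (z i j - 2 * \<sigma>) < 0" using z[OF ij] \<sigma> by simp
  qed
  then have "((\<lambda>t. Re (\<phi> t)) \<longlongrightarrow> 0) at_top"
    using tendsto_Re by fastforce
  \<comment> \<open>\<open>Re (\<phi> 0)\<close> is a lower bound for the values
    \<open>Re (\<phi> t)\<close>, which tend to 0. It is the difference of the two double sums to be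
    compared.\<close>
  then have "Re (\<phi> 0) \<le> 0"
    using mono by (intro tendsto_lowerbound) (auto intro: eventually_at_top_linorderI[of 0])
  moreover have "\<phi> 0 = (\<Sum>i\<in>I. \<Sum>j\<in>I. cnj (r i) * r j / (2 * \<sigma> - cnj (p i) - p j)) -
      (\<Sum>i\<in>I. \<Sum>j\<in>I. cnj (r i) * r j / (- cnj (p i) - p j))"
    unfolding \<phi>_def sum_subtractf[symmetric]
  proof (intro sum.cong refl)
    fix i j assume ij: "i \<in> I" "j \<in> I"
    have "2 * \<sigma> - cnj (p i) - p j = - (z i j - 2 * \<sigma>)" "- cnj (p i) - p j = - z i j"
      by (auto simp: z_def)
    then show "cnj (r i) * r j * (exp (of_real 0 * z i j) / z i j -
        exp (of_real 0 * (z i j - 2 * \<sigma>)) / (z i j - 2 * \<sigma>)) =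
      cnj (r i) * r j / (2 * \<sigma> - cnj (p i) - p j) - cnj (r i) * r j / (- cnj (p i) - p j)"
      by (simp only: divide_minus_right) (simp add: algebra_simps)
  qed
  ultimately show ?thesis by simp
qed

text \<open>Moving the line by \<open>\<sigma>\<close> amounts to moving the poles by
  \<open>-\<sigma>\<close>, which keeps them in the left half plane. Both factors of the squared
  norm carry the shift, hence \<open>2 * \<sigma>\<close> in the denominators.\<close>

lemma norm_sq_pole_sum_shift:
  fixes p r :: "'i \<Rightarrow> complex" and \<sigma> :: real
  assumes I: "finite I" "\<And>i. i \<in> I \<Longrightarrow> Re (p i) < 0" and \<sigma>: "0 \<le> \<sigma>"
  shows "(\<integral>w. (cmod (\<Sum>i\<in>I. r i / (\<sigma> + \<i> * complex_of_real w - p i)))\<^sup>2 \<partial>lborel)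
    = 2 * pi * Re (\<Sum>i\<in>I. \<Sum>j\<in>I. cnj (r i) * r j / (2 * \<sigma> - cnj (p i) - p j))"
proof -
  let ?q = "\<lambda>i. p i - \<sigma>"
  have q: "Re (?q i) < 0" if "i \<in> I" for i using I(2)[OF that] \<sigma> by simp
  have "complex_of_real (\<integral>w. (cmod (\<Sum>i\<in>I. r i / (\<sigma> + \<i> * complex_of_real w - p i)))\<^sup>2 \<partial>lborel)
    = complex_of_real (\<integral>w. (cmod (\<Sum>i\<in>I. r i / (\<i> * complex_of_real w - ?q i)))\<^sup>2 \<partial>lborel)"
    by (simp add: algebra_simps)
  also have "\<dots> = 2 * pi * (\<Sum>i\<in>I. cnj (r i) * (\<Sum>j\<in>I. r j / (- cnj (?q i) - ?q j)))"
    unfolding integral_norm_sq_eq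
    using I(1) q by (intro inner_product_pole_sum rhp_decay_pole_sum)
  also have "\<dots> = 2 * pi * (\<Sum>i\<in>I. \<Sum>j\<in>I. cnj (r i) * r j / (2 * \<sigma> - cnj (p i) - p j))"
    by (simp add: sum_distrib_left algebra_simps)
  finally have "Re (complex_of_real (\<integral>w. (cmod (\<Sum>i\<in>I. r i / (\<sigma> + \<i> * complex_of_real w - p i)))\<^sup>2 \<partial>lborel))
    = Re (complex_of_real (2 * pi) * (\<Sum>i\<in>I. \<Sum>j\<in>I. cnj (r i) * r j / (2 * \<sigma> - cnj (p i) - p j)))"
    by simp
  then show ?thesis by simp
qed

lemma norm_sq_pole_sum_shift_le:
  fixes p r :: "'i \<Rightarrow> complex" and \<sigma> :: real
  assumes I: "finite I" "\<And>i. i \<in> I \<Longrightarrow> Re (p i) < 0" and \<sigma>: "0 \<le> \<sigma>"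
  shows "(\<integral>w. (cmod (\<Sum>i\<in>I. r i / (\<sigma> + \<i> * complex_of_real w - p i)))\<^sup>2 \<partial>lborel)
    \<le> (\<integral>w. (cmod (\<Sum>i\<in>I. r i / (\<i> * complex_of_real w - p i)))\<^sup>2 \<partial>lborel)"
  using norm_sq_pole_sum_shift[OF I \<sigma>, where r = r] norm_sq_pole_sum_shift[OF I, where r = r and \<sigma> = 0]
    cauchy_form_antimono[OF I \<sigma>, where r = r] by simp

section \<open>Real polynomials and their complex zeros\<close>

lemma coeff_cpoly [simp]: "coeff (cpoly p) n = of_real (coeff p n)"
  by (simp add: cpoly_def coeff_map_poly)

lemma degree_cpoly [simp]: "degree (cpoly p) = degree p"
  by (simp add: cpoly_def degree_map_poly)

lemma cpoly_eq_0_iff [simp]: "cpoly p = 0 \<longleftrightarrow> p = 0"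
  by (simp add: poly_eq_iff)

lemma cpoly_0 [simp]: "cpoly 0 = 0"
  by (simp add: cpoly_def)

lemma cpoly_minus [simp]: "cpoly (- p) = - cpoly p"
  by (simp add: poly_eq_iff)

lemma cpoly_1 [simp]: "cpoly 1 = 1"
  by (simp add: cpoly_def)

lemma cpoly_pCons [simp]: "cpoly (pCons c p) = pCons (of_real c) (cpoly p)"
  by (simp add: cpoly_def map_poly_pCons)

lemma cpoly_add [simp]: "cpoly (p + q) = cpoly p + cpoly q"
  by (simp add: poly_eq_iff)

lemma cpoly_diff [simp]: "cpoly (p - q) = cpoly p - cpoly q"
  by (simp add: poly_eq_iff)

lemma cpoly_mult [simp]: "cpoly (p * q) = cpoly p * cpoly q"
  by (simp add: poly_eq_iff coeff_mult)

lemma cpoly_power [simp]: "cpoly (p ^ n) = cpoly p ^ n"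
  by (induction n) simp_all

lemma cpoly_smult [simp]: "cpoly (smult c p) = smult (of_real c) (cpoly p)"
  by (simp add: poly_eq_iff)

lemma poly_cpoly_of_real: "poly (cpoly p) (of_real x) = of_real (poly p x)"
  by (induction p) (simp_all add: cpoly_def map_poly_pCons)

lemma poly_cpoly_cnj: "poly (cpoly p) (cnj z) = cnj (poly (cpoly p) z)"
  by (induction p) (simp_all add: cpoly_def map_poly_pCons)

lemma poly_cpoly_negarg [simp]: "poly (cpoly (negarg p)) z = poly (cpoly p) (- z)"
  by (induction p) (simp_all add: negarg_def pcompose_pCons)

lemma degree_negarg [simp]: "degree (negarg p) = degree p"
  by (simp add: negarg_def degree_pcompose)

lemma negarg_eq_0_iff [simp]: "negarg p = 0 \<longleftrightarrow> p = 0"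
  by (auto simp: negarg_def dest: pcompose_eq_0)

text \<open>Negation is conjugation on the imaginary axis, and real polynomials commute with
  conjugation.\<close>

lemma poly_cpoly_neg_axis:
  "poly (cpoly p) (- (\<i> * complex_of_real w)) = cnj (poly (cpoly p) (\<i> * complex_of_real w))"
  by (simp flip: poly_cpoly_cnj)

lemma finite_croots: "p \<noteq> 0 \<Longrightarrow> finite (croots p)"
  by (simp add: croots_def poly_roots_finite)

lemma finite_axis_roots:
  assumes "p \<noteq> 0"
  shows "finite {w. poly (cpoly p) (\<i> * complex_of_real w) = 0}"
  by (rule finite_imageD[of "\<lambda>w. \<i> * complex_of_real w", OF finite_subset[OF _ finite_croots[OF assms]]])
     (auto simp: croots_def inj_on_def)

lemma AE_axis_nonroot:
  assumes "p \<noteq> 0"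
  shows "AE w in lborel. poly (cpoly p) (\<i> * complex_of_real w) \<noteq> 0"
  using AE_not_in[OF countable_imp_null_set_lborel[OF countable_finite[OF finite_axis_roots[OF assms]]]]
  by simp

lemma hurwitz_nonzero: "hurwitz p \<Longrightarrow> 0 \<le> Re z \<Longrightarrow> poly (cpoly p) z \<noteq> 0"
  by (force simp: hurwitz_def)

lemma hurwitz_imp_nonzero: "hurwitz p \<Longrightarrow> p \<noteq> 0"
  using hurwitz_nonzero[of p 0] by auto

lemma hurwitz_mult: "hurwitz p \<Longrightarrow> hurwitz q \<Longrightarrow> hurwitz (p * q)"
  by (auto simp: hurwitz_def)

lemma hurwitz_power: "hurwitz p \<Longrightarrow> hurwitz (p ^ n)"
  by (auto simp: hurwitz_def)

lemma hurwitz_linear: "0 < l \<Longrightarrow> hurwitz [:l, 1:]"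
  by (auto simp: hurwitz_def add_eq_0_iff)

lemma degree_0_imp_hurwitz: "p \<noteq> 0 \<Longrightarrow> degree p = 0 \<Longrightarrow> hurwitz p"
  by (auto simp: hurwitz_def elim!: degree_eq_zeroE)

section \<open>Coprimality and real factorisation through complex zeros\<close>

lemma coprime_imp_no_common_croot:
  assumes "coprime p q" "poly (cpoly p) z = 0"
  shows "poly (cpoly q) z \<noteq> 0"
proof
  assume "poly (cpoly q) z = 0"
  moreover have "fst (bezout_coefficients p q) * p + snd (bezout_coefficients p q) * q = 1"
    using assms(1) by (simp add: bezout_coefficients_fst_snd)
  then have "poly (cpoly (fst (bezout_coefficients p q) * p + snd (bezout_coefficients p q) * q)) z = 1"
    by simp
  ultimately show False using assms(2) by simp
qed

text \<open>A nonconstant common divisor would have a complex zero.\<close>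

lemma no_common_croot_imp_coprime:
  assumes "p \<noteq> 0" "\<And>z. poly (cpoly p) z = 0 \<Longrightarrow> poly (cpoly q) z \<noteq> 0"
  shows "coprime p q"
proof -
  obtain p' q' where pq: "p = gcd p q * p'" "q = gcd p q * q'" by (meson dvdE gcd_dvd1 gcd_dvd2)
  have "degree (gcd p q) = 0"
  proof (rule ccontr)
    assume "degree (gcd p q) \<noteq> 0"
    then obtain z where "poly (cpoly (gcd p q)) z = 0"
      using alg_closed_imp_poly_has_root[of "cpoly (gcd p q)"] by auto
    then have "poly (cpoly p) z = 0" "poly (cpoly q) z = 0"
      by (subst pq, simp)+
    then show False using assms(2) by blast
  qed
  then have "is_unit (gcd p q)"
    using assms(1) is_unit_iff_degree[of "gcd p q"] by (metis gcd_eq_0_iff)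
  then show ?thesis by (simp add: coprime_iff_gcd_eq_1)
qed

text \<open>Keeps factors real while controlling the real part of their zeros: a linear factor for a
  real zero, otherwise the quadratic with zeros \<open>z\<close> and \<open>cnj z\<close>.\<close>

lemma real_factor_of_root:
  assumes "poly (cpoly p) z = 0"
  obtains m where "m dvd p" "lead_coeff m = 1" "degree m > 0"
    "\<And>w. poly (cpoly m) w = 0 \<Longrightarrow> Re w = Re z"
proof (cases "Im z = 0")
  case True
  then have z: "z = of_real (Re z)" by (simp add: complex_eq_iff)
  then have "poly p (Re z) = 0" using assms by (metis poly_cpoly_of_real of_real_eq_0_iff)
  then have "[:- Re z, 1:] dvd p" by (simp add: poly_eq_0_iff_dvd)
  then show ?thesis by (rule that) (auto simp: complex_eq_iff)
next
  case False
  define m where "m = [:(Re z)\<^sup>2 + (Im z)\<^sup>2, - 2 * Re z, 1:]"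
  have m: "poly (cpoly m) w = (w - z) * (w - cnj z)" for w
    by (simp add: m_def complex_eq_iff power2_eq_square algebra_simps)
  \<comment> \<open>The remainder is real of degree at most 1, so vanishing at the nonreal
    \<open>z\<close> forces both of its coefficients to be 0.\<close>
  have "poly (cpoly (p mod m)) z = 0"
  proof -
    have "poly (cpoly (p div m * m + p mod m)) z = 0" using assms by simp
    then show ?thesis unfolding cpoly_add cpoly_mult poly_add poly_mult m by simp
  qed
  moreover have "degree (p mod m) < 2 \<or> p mod m = 0"
    using degree_mod_less[of m p] by (auto simp: m_def)
  then have r: "p mod m = [:coeff (p mod m) 0, coeff (p mod m) 1:]" (is "_ = [:?c0, ?c1:]")
    by (intro poly_eqI) (auto simp: coeff_pCons coeff_eq_0 split: nat.splits)
  ultimately have "poly (cpoly [:?c0, ?c1:]) z = 0" by simp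
  then have "?c1 * Im z = 0" "?c0 + ?c1 * Re z = 0"
    by (auto simp: complex_eq_iff mult.commute)
  then have "p mod m = 0" using False r by (metis mult_eq_0_iff mult_zero_left add_0_right pCons_0_0)
  then have "m dvd p" by (simp add: mod_eq_0_iff_dvd)
  then show ?thesis
    by (rule that) (simp_all add: m, simp_all add: m_def, auto)
qed

text \<open>Real factors with zeros in the open left half plane are split off one at a time, by
  induction on the degree.\<close>

lemma hurwitz_split:
  assumes "p \<noteq> 0"
  obtains ps pu where "p = ps * pu" "hurwitz ps" "lead_coeff ps = 1"
    "\<And>z. poly (cpoly pu) z = 0 \<Longrightarrow> 0 \<le> Re z"
proof -
  have "\<exists>ps pu. p = ps * pu \<and> hurwitz ps \<and> lead_coeff ps = 1 \<and> (\<forall>z. poly (cpoly pu) z = 0 \<longrightarrow> 0 \<le> Re z)"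
    using assms
  proof (induction "degree p" arbitrary: p rule: less_induct)
    case less
    show ?case
    proof (cases "\<exists>z. poly (cpoly p) z = 0 \<and> Re z < 0")
      case False
      then show ?thesis by (intro exI[of _ 1] exI[of _ p]) (force simp: hurwitz_def)
    next
      case True
      then obtain z where "poly (cpoly p) z = 0" "Re z < 0" by blast
      then obtain m where m: "m dvd p" "lead_coeff m = 1" "degree m > 0" "hurwitz m"
        by (metis real_factor_of_root hurwitz_def)
      then obtain p' where p': "p = m * p'" by auto
      then have "p' \<noteq> 0" "degree p' < degree p" using less.prems m(3) by (auto simp: degree_mult_eq)
      then obtain ps pu where "p' = ps * pu" "hurwitz ps" "lead_coeff ps = 1"
        "\<forall>z. poly (cpoly pu) z = 0 \<longrightarrow> 0 \<le> Re z"
        using less.hyps by blast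
      then show ?thesis
        using m p' by (intro exI[of _ "m * ps"] exI[of _ pu]) (auto simp: hurwitz_mult lead_coeff_mult)
    qed
  qed
  then show ?thesis using that by blast
qed

text \<open>In modulus \<open>-s\<close> may be replaced by \<open>- cnj s\<close>, the mirror image
  of \<open>s\<close> in the imaginary axis. It is no farther than \<open>s\<close> from any zero in
  the left half plane, so the linear factors compare one by one.\<close>

lemma hurwitz_reflection_bound:
  assumes "hurwitz p" "0 \<le> Re s"
  shows "cmod (poly (cpoly p) (- s)) \<le> cmod (poly (cpoly p) s)"
proof -
  obtain root where root: "smult (lead_coeff (cpoly p)) (\<Prod>i<degree (cpoly p). [:- root i, 1:]) = cpoly p"
    by (rule complex_poly_decompose')
  have ev: "poly (cpoly p) z = lead_coeff (cpoly p) * (\<Prod>i<degree (cpoly p). z - root i)" for z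
    by (subst root[symmetric]) (simp add: poly_prod)
  have neg: "Re (root i) < 0" if "i < degree (cpoly p)" for i
  proof -
    have "poly (cpoly p) (root i) = 0"
      unfolding ev using that by (auto intro!: prod_zero)
    then show ?thesis using assms(1) by (simp add: hurwitz_def)
  qed
  have "cmod (poly (cpoly p) (- s)) = cmod (poly (cpoly p) (- cnj s))"
    using poly_cpoly_cnj[of p "- s"] by simp
  also have "\<dots> \<le> cmod (poly (cpoly p) s)"
    unfolding ev norm_mult prod_norm[symmetric]
  proof (intro mult_left_mono prod_mono conjI)
    fix i assume "i \<in> {..<degree (cpoly p)}"
    then have "(- Re s - Re (root i))\<^sup>2 \<le> (Re s - Re (root i))\<^sup>2"
      using neg[of i] assms(2) by (intro power2_le_iff_abs_le[THEN iffD2]) auto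
    then show "cmod (- cnj s - root i) \<le> cmod (s - root i)"
      by (simp add: cmod_def)
  qed auto
  finally show ?thesis .
qed

text \<open>Lagrange interpolation of \<open>p\<close> at the zeros of \<open>q\<close>, with
  \<open>L z\<close> the product of the other linear factors. The identity
  \<open>poly (pderiv q) z = poly (L z) z\<close> turns the Lagrange coefficients into
  residues.\<close>

lemma partial_fraction_simple_roots:
  fixes p q :: "complex poly"
  assumes q: "lead_coeff q = 1" "card {z. poly q z = 0} = degree q" and p: "degree p < degree q"
    and s: "poly q s \<noteq> 0"
  shows "poly p s / poly q s = (\<Sum>z | poly q z = 0. poly p z / poly (pderiv q) z / (s - z))"
proof -
  define A where "A = {z. poly q z = 0}"
  have q0: "q \<noteq> 0" using q(1) by auto
  then have fin: "finite A" unfolding A_def by (rule poly_roots_finite)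
  have cardA: "card A = degree q" using q(2) by (simp add: A_def)
  have deg: "degree (\<Prod>z\<in>B. [:- z, 1:]) = card B" for B :: "complex set"
    by (simp add: degree_prod_sum_eq)
  \<comment> \<open>The two polynomials agree at \<open>degree q\<close> points and in the
    coefficient of that degree.\<close>
  have qA: "q = (\<Prod>z\<in>A. [:- z, 1:])"
  proof (rule poly_eqI_degree_lead_coeff[where A = A and n = "degree q"])
    show "coeff q (degree q) = coeff (\<Prod>z\<in>A. [:- z, 1:]) (degree q)"
      using lead_coeff_prod[of "\<lambda>z. [:- z, 1:]" A] by (simp add: deg cardA q(1))
    show "poly q z = poly (\<Prod>z\<in>A. [:- z, 1:]) z" if "z \<in> A" for z
      using that fin by (auto simp: poly_prod A_def)
  qed (auto simp: deg cardA)
  define L where "L z = (\<Prod>w\<in>A - {z}. [:- w, 1:])" for z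
  have L0: "poly (L z) w = 0" if "z \<in> A" "w \<in> A" "w \<noteq> z" for z w
    using that fin by (auto simp: L_def poly_prod)
  have dq: "poly (pderiv q) z = poly (L z) z" if "z \<in> A" for z
  proof -
    have "poly (pderiv q) z = (\<Sum>w\<in>A. poly (L w) z)"
      by (subst qA) (simp add: pderiv_prod poly_sum L_def pderiv_pCons)
    also have "\<dots> = (\<Sum>w\<in>A. if w = z then poly (L z) z else 0)"
      using L0 that by (intro sum.cong) auto
    finally show ?thesis using that fin by simp
  qed
  have Lz: "poly (L z) z \<noteq> 0" for z
    using fin by (auto simp: L_def poly_prod)
  have pL: "p = (\<Sum>z\<in>A. smult (poly p z / poly (pderiv q) z) (L z))"
  proof (rule poly_eqI_degree[where A = A])
    fix w assume w: "w \<in> A"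
    have "(\<Sum>z\<in>A. poly p z / poly (pderiv q) z * poly (L z) w) = (\<Sum>z\<in>A. if z = w then poly p w else 0)"
      using L0 w Lz dq by (intro sum.cong) auto
    then show "poly p w = poly (\<Sum>z\<in>A. smult (poly p z / poly (pderiv q) z) (L z)) w"
      using w fin by (simp add: poly_sum)
  next
    have "degree (L z) < card A" if "z \<in> A" for z
      using that fin deg[of "A - {z}"] card_gt_0_iff[of A] by (auto simp: L_def)
    then show "degree (\<Sum>z\<in>A. smult (poly p z / poly (pderiv q) z) (L z)) < card A"
      using p cardA by (intro degree_sum_less) (auto intro: le_less_trans[OF degree_smult_le])
  qed (use p cardA in auto)
  have Ls: "poly (L z) s / poly q s = 1 / (s - z)" if "z \<in> A" for z
  proof -
    have "q = [:- z, 1:] * L z"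
      unfolding L_def by (subst qA) (rule prod.remove[OF fin that])
    then have "poly q s = (s - z) * poly (L z) s" using poly_mult[of "[:- z, 1:]" "L z" s] by simp
    then show ?thesis using s by auto
  qed
  have "poly p s / poly q s = (\<Sum>z\<in>A. poly p z / poly (pderiv q) z * (poly (L z) s / poly q s))"
    by (subst pL) (simp add: poly_sum sum_divide_distrib)
  also have "\<dots> = (\<Sum>z\<in>A. poly p z / poly (pderiv q) z / (s - z))"
    using Ls by (intro sum.cong) auto
  finally show ?thesis by (simp add: A_def)
qed

section \<open>Norms of rational functions\<close>

lemma rhp_decay_rat_fun:
  assumes "hurwitz q" "p = 0 \<or> degree p < degree q"
  shows "rhp_decay 1 (rat_fun p q)"
  unfolding rat_fun_def
  using rhp_decay_poly_divide[of "cpoly q" "cpoly p" 1] assms hurwitz_nonzero hurwitz_imp_nonzero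
  by auto

lemma rat_fun_vertical_measurable [measurable]:
  "(\<lambda>w. rat_fun p q (\<sigma> + \<i> * complex_of_real w)) \<in> borel_measurable borel"
  unfolding rat_fun_def
  by (intro borel_measurable_divide borel_measurable_continuous_onI) (auto intro!: continuous_intros)

lemma rat_fun_axis_measurable [measurable]:
  "(\<lambda>w. rat_fun p q (\<i> * complex_of_real w)) \<in> borel_measurable borel"
  using rat_fun_vertical_measurable[of p q 0] by simp

lemma L2_sq_nonneg: "0 \<le> L2_sq t"
  by (simp add: L2_sq_def)

text \<open>Serves where identities between fractions fail at the finitely many zeros of a
  denominator on the axis.\<close>

lemma L2_sq_cong_AE:
  assumes "(\<lambda>w. f (\<i> * complex_of_real w)) \<in> borel_measurable borel"
    "(\<lambda>w. g (\<i> * complex_of_real w)) \<in> borel_measurable borel"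
    "AE w in lborel. cmod (f (\<i> * complex_of_real w)) = cmod (g (\<i> * complex_of_real w))"
  shows "L2_sq f = L2_sq g" "L2_finite f \<longleftrightarrow> L2_finite g"
proof -
  have "AE w in lborel. (cmod (f (\<i> * complex_of_real w)))\<^sup>2 = (cmod (g (\<i> * complex_of_real w)))\<^sup>2"
    using assms(3) by eventually_elim simp
  note AE = _ _ this
  show "L2_sq f = L2_sq g" unfolding L2_sq_def
    by (subst integral_cong_AE[OF AE]) (use assms(1,2) in measurable)
  show "L2_finite f \<longleftrightarrow> L2_finite g" unfolding L2_finite_def
    by (rule integrable_cong_AE[OF AE]) (use assms(1,2) in measurable)
qed

lemma L2_sq_axis_cong:
  assumes "\<And>w::real. f (\<i> * of_real w) = g (\<i> * of_real w)"
  shows "L2_sq f = L2_sq g"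
  unfolding L2_sq_def assms ..

section \<open>Inner products and orthogonality on the axis\<close>

lemma L2_sq_diff_scaled:
  fixes c :: real
  assumes f: "rhp_decay 1 f" and g: "rhp_decay 1 g"
  shows "L2_sq (\<lambda>s. f s - of_real c * g s) = L2_sq f
    - 2 * c * (Re (\<integral>w. f (\<i> * complex_of_real w) * cnj (g (\<i> * complex_of_real w)) \<partial>lborel) / (2 * pi))
    + c\<^sup>2 * L2_sq g"
proof -
  let ?F = "\<lambda>w. f (\<i> * complex_of_real w)" and ?G = "\<lambda>w. g (\<i> * complex_of_real w)"
  note int = rhp_decay_norm_sq_integrable[OF f] rhp_decay_norm_sq_integrable[OF g]
    rhp_decay_mult_cnj_integrable[OF f g]
  have "(cmod (z - of_real c * w))\<^sup>2 = (cmod z)\<^sup>2 - 2 * c * Re (z * cnj w) + c\<^sup>2 * (cmod w)\<^sup>2" for z w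
    unfolding cmod_power2 by (simp add: power2_eq_square algebra_simps)
  then have "(\<integral>w. (cmod (?F w - of_real c * ?G w))\<^sup>2 \<partial>lborel) =
      (\<integral>w. (cmod (?F w))\<^sup>2 - 2 * c * Re (?F w * cnj (?G w)) + c\<^sup>2 * (cmod (?G w))\<^sup>2 \<partial>lborel)"
    by simp
  also have "\<dots> = (\<integral>w. (cmod (?F w))\<^sup>2 \<partial>lborel) - 2 * c * Re (\<integral>w. ?F w * cnj (?G w) \<partial>lborel)
      + c\<^sup>2 * (\<integral>w. (cmod (?G w))\<^sup>2 \<partial>lborel)"
    using int integrable_Re[OF int(3)] integral_Re[OF int(3)]
    by (simp del: times_complex.sel)
  finally show ?thesis
    unfolding L2_sq_def by (simp add: diff_divide_distrib add_divide_distrib)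
qed

text \<open>The product \<open>f * h\<close> has decay of order 2, so its integral vanishes:
  \<open>f\<close> is orthogonal to \<open>g\<close> on the axis. In the application
  \<open>g\<close> is an antistable fraction.\<close>

lemma L2_sq_pythagoras_le:
  assumes f: "rhp_decay 1 f" and h: "rhp_decay 1 h"
    and g: "\<And>w. g (\<i> * complex_of_real w) = cnj (h (\<i> * complex_of_real w))"
  shows "L2_sq f \<le> L2_sq (\<lambda>s. f s - g s)"
proof -
  let ?F = "\<lambda>w. f (\<i> * complex_of_real w)" and ?H = "\<lambda>w. h (\<i> * complex_of_real w)"
  note int = rhp_decay_norm_sq_integrable[OF f] rhp_decay_norm_sq_integrable[OF h]
    rhp_decay_mult_integrable[OF f h]
  have 0: "(\<integral>w. ?F w * ?H w \<partial>lborel) = 0"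
    using rhp_decay_mult[OF f h] rhp_decay_2_integral_eq_0[of "\<lambda>s. f s * h s"]
    by (simp add: numeral_2_eq_2)
  have "(cmod (z - cnj w))\<^sup>2 = (cmod z)\<^sup>2 - 2 * Re (z * w) + (cmod w)\<^sup>2" for z w
    unfolding cmod_power2 by (simp add: power2_eq_square algebra_simps)
  then have "(\<integral>w. (cmod (?F w - g (\<i> * complex_of_real w)))\<^sup>2 \<partial>lborel) =
      (\<integral>w. (cmod (?F w))\<^sup>2 - 2 * Re (?F w * ?H w) + (cmod (?H w))\<^sup>2 \<partial>lborel)"
    by (simp add: g)
  also have "\<dots> = (\<integral>w. (cmod (?F w))\<^sup>2 \<partial>lborel) + (\<integral>w. (cmod (?H w))\<^sup>2 \<partial>lborel)"
    using int integrable_Re[OF int(3)] integral_Re[OF int(3)] 0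
    by (simp del: times_complex.sel)
  finally show ?thesis
    unfolding L2_sq_def by (simp add: divide_right_mono)
qed

section \<open>Norms of fractions with simple poles\<close>

lemma rat_fun_eq_pole_sum:
  assumes "lead_coeff d = 1" "card (croots d) = degree d" "degree a < degree d" "poly (cpoly d) s \<noteq> 0"
  shows "rat_fun a d s =
    (\<Sum>\<delta>\<in>croots d. poly (cpoly a) \<delta> / poly (pderiv (cpoly d)) \<delta> / (s - \<delta>))"
  unfolding rat_fun_def croots_def
  using assms by (intro partial_fraction_simple_roots) (auto simp: croots_def)

text \<open>One factor of the squared modulus is expanded in partial fractions; the reproducing
  property evaluates the other at the reflected poles.\<close>

lemma L2_sq_rat_fun_simple_roots:
  assumes d: "lead_coeff d = 1" "card (croots d) = degree d" "hurwitz d" and a: "degree a < degree d"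
  shows "complex_of_real (L2_sq (rat_fun a d)) = (\<Sum>\<delta>\<in>croots d.
    poly (cpoly a) \<delta> * poly (cpoly a) (- \<delta>) / (poly (pderiv (cpoly d)) \<delta> * poly (cpoly d) (- \<delta>)))"
proof -
  let ?r = "\<lambda>\<delta>. poly (cpoly a) \<delta> / poly (pderiv (cpoly d)) \<delta>"
  have neg: "Re \<delta> < 0" if "\<delta> \<in> croots d" for \<delta> using d(3) that by (auto simp: hurwitz_def croots_def)
  have fin: "finite (croots d)" using d(3) by (intro finite_croots hurwitz_imp_nonzero)
  have nz: "poly (cpoly d) (\<i> * complex_of_real w) \<noteq> 0" for w using d(3) by (intro hurwitz_nonzero) auto
  note exp = rat_fun_eq_pole_sum[OF d(1,2) a nz]
  have cn: "cnj (rat_fun a d (- cnj \<delta>)) = rat_fun a d (- \<delta>)" for \<delta>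
    using poly_cpoly_cnj[of _ "- \<delta>"] by (simp add: rat_fun_def)
  have "complex_of_real (2 * pi * L2_sq (rat_fun a d)) =
      (\<integral>w. rat_fun a d (\<i> * complex_of_real w) * cnj (rat_fun a d (\<i> * complex_of_real w)) \<partial>lborel)"
    unfolding integral_norm_sq_eq[symmetric] L2_sq_def by simp
  also have "\<dots> = (\<integral>w. rat_fun a d (\<i> * complex_of_real w) *
      cnj (\<Sum>\<delta>\<in>croots d. ?r \<delta> / (\<i> * complex_of_real w - \<delta>)) \<partial>lborel)"
    by (simp only: exp[symmetric])
  also have "\<dots> = 2 * pi * (\<Sum>\<delta>\<in>croots d. cnj (?r \<delta>) * rat_fun a d (- cnj \<delta>))"
    using neg fin a by (intro inner_product_pole_sum rhp_decay_rat_fun[OF d(3)]) auto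
  finally have "complex_of_real (L2_sq (rat_fun a d)) = (\<Sum>\<delta>\<in>croots d. cnj (?r \<delta>) * rat_fun a d (- cnj \<delta>))"
    by simp
  \<comment> \<open>The left side is real, so conjugating the identity removes the conjugations on
    the right.\<close>
  then have "cnj (complex_of_real (L2_sq (rat_fun a d))) = (\<Sum>\<delta>\<in>croots d. ?r \<delta> * rat_fun a d (- \<delta>))"
    by (simp only: cnj_sum complex_cnj_mult cn complex_cnj_cnj)
  then show ?thesis by (simp add: rat_fun_def)
qed

lemma rat_fun_shift_L2_le:
  assumes d: "lead_coeff d = 1" "card (croots d) = degree d" "hurwitz d" and a: "degree a < degree d"
    and \<sigma>: "0 \<le> \<sigma>"
  shows "(\<integral>w. (cmod (rat_fun a d (of_real \<sigma> + \<i> * complex_of_real w)))\<^sup>2 \<partial>lborel)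
    \<le> (\<integral>w. (cmod (rat_fun a d (\<i> * complex_of_real w)))\<^sup>2 \<partial>lborel)"
proof -
  have neg: "Re \<delta> < 0" if "\<delta> \<in> croots d" for \<delta> using d(3) that by (auto simp: hurwitz_def croots_def)
  have fin: "finite (croots d)" using d(3) by (intro finite_croots hurwitz_imp_nonzero)
  have nz: "poly (cpoly d) (\<i> * complex_of_real w) \<noteq> 0"
    "poly (cpoly d) (of_real \<sigma> + \<i> * complex_of_real w) \<noteq> 0" for w
    using \<sigma> by (intro hurwitz_nonzero[OF d(3)]; simp)+
  show ?thesis
    unfolding rat_fun_eq_pole_sum[OF d(1,2) a nz(1)] rat_fun_eq_pole_sum[OF d(1,2) a nz(2)]
    by (intro norm_sq_pole_sum_shift_le fin neg \<sigma>)
qed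

text \<open>A majorant uniform in \<open>\<sigma>\<close>, for dominated convergence as the line
  approaches the axis. Moving right increases the distance to every pole, so each simple fraction is
  largest on the axis.\<close>

lemma rat_fun_shift_dominated:
  assumes d: "lead_coeff d = 1" "card (croots d) = degree d" "hurwitz d" and a: "degree a < degree d"
  obtains g where "integrable lborel g"
    "\<And>\<sigma> w. 0 \<le> \<sigma> \<Longrightarrow> (cmod (rat_fun a d (of_real \<sigma> + \<i> * complex_of_real w)))\<^sup>2 \<le> g w"
proof
  let ?r = "\<lambda>\<delta>. poly (cpoly a) \<delta> / poly (pderiv (cpoly d)) \<delta>"
  define g where "g w = (\<Sum>\<delta>\<in>croots d. cmod (?r \<delta>) * cmod (1 / (\<i> * complex_of_real w - \<delta>)))\<^sup>2" for w
  have neg: "Re \<delta> < 0" if "\<delta> \<in> croots d" for \<delta> using d(3) that by (auto simp: hurwitz_def croots_def)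
  have "integrable lborel (\<lambda>w. \<Sum>\<delta>\<in>croots d. \<Sum>\<eta>\<in>croots d. cmod (?r \<delta>) * cmod (?r \<eta>) *
      cmod (1 / (\<i> * complex_of_real w - \<delta>) * cnj (1 / (\<i> * complex_of_real w - \<eta>))))"
    by (intro Bochner_Integration.integrable_sum integrable_mult_right integrable_norm
        rhp_decay_mult_cnj_integrable[of "\<lambda>s. 1 / (s - _)" "\<lambda>s. 1 / (s - _)"] rhp_decay_simple_pole neg)
  then show "integrable lborel g"
    unfolding g_def power2_eq_square sum_product norm_mult complex_mod_cnj by (simp only: mult_ac)
  show "(cmod (rat_fun a d (of_real \<sigma> + \<i> * complex_of_real w)))\<^sup>2 \<le> g w" if \<sigma>: "0 \<le> \<sigma>" for \<sigma> w
  proof -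
    have nz: "poly (cpoly d) (of_real \<sigma> + \<i> * complex_of_real w) \<noteq> 0"
      using \<sigma> by (intro hurwitz_nonzero[OF d(3)]; simp)+
    have "cmod (\<Sum>\<delta>\<in>croots d. ?r \<delta> / (of_real \<sigma> + \<i> * complex_of_real w - \<delta>)) \<le>
      (\<Sum>\<delta>\<in>croots d. cmod (?r \<delta>) * cmod (1 / (\<i> * complex_of_real w - \<delta>)))"
    proof (rule sum_norm_le)
      fix \<delta> assume "\<delta> \<in> croots d"
      then have *: "Re \<delta> < 0" by (rule neg)
      have "(Re \<delta>)\<^sup>2 \<le> (\<sigma> - Re \<delta>)\<^sup>2"
        using * \<sigma> by (intro power2_le_iff_abs_le[THEN iffD2]) auto
      then have "cmod (\<i> * complex_of_real w - \<delta>) \<le> cmod (of_real \<sigma> + \<i> * complex_of_real w - \<delta>)"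
        by (simp add: cmod_def)
      moreover have "0 < cmod (\<i> * complex_of_real w - \<delta>)" using * by auto
      ultimately have "1 / cmod (of_real \<sigma> + \<i> * complex_of_real w - \<delta>) \<le> 1 / cmod (\<i> * complex_of_real w - \<delta>)"
        by (intro divide_left_mono mult_pos_pos) linarith+
      from mult_left_mono[OF this norm_ge_zero[of "?r \<delta>"]]
      show "cmod (?r \<delta> / (of_real \<sigma> + \<i> * complex_of_real w - \<delta>)) \<le>
        cmod (?r \<delta>) * cmod (1 / (\<i> * complex_of_real w - \<delta>))"
        by (simp only: norm_divide norm_one) simp
    qed
    then show ?thesis
      unfolding g_def rat_fun_eq_pole_sum[OF d(1,2) a nz] by (intro power_mono) auto
  qed
qed

section \<open>The interpolation error\<close>

locale interpolation_data =
  fixes N :: nat and d e a b :: "real poly" and q0 :: real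
  assumes N: "N \<ge> 2"
    and d_monic: "lead_coeff d = 1" and d_deg: "degree d = N"
    and d_simple: "card (croots d) = N" and d_roots: "\<forall>\<delta>\<in>croots d. Re \<delta> < 0"
    and e_deg: "degree e \<le> N - 1" and coprime_e_d: "coprime e d"
    and a_monic: "lead_coeff a = 1" and a_deg: "degree a = N - 1"
    and eq: "d * b = e * a - smult q0 ((negarg a)\<^sup>2)"
begin

abbreviation err :: "complex \<Rightarrow> complex" where
  "err \<equiv> (\<lambda>z. rat_fun e d z - rat_fun b a z)"

lemma hurwitz_d: "hurwitz d"
  using d_roots by (auto simp: hurwitz_def croots_def)

lemma a_nonzero: "a \<noteq> 0"
  using a_monic by auto

lemma d_nonzero: "d \<noteq> 0"
  using d_monic by auto

lemma d_axis: "poly (cpoly d) (\<i> * complex_of_real w) \<noteq> 0"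
  by (rule hurwitz_nonzero[OF hurwitz_d]) simp

lemma simple_d: "card (croots d) = degree d"
  by (simp add: d_simple d_deg)

lemma deg_a_less: "degree a < degree d"
  using N by (simp add: a_deg d_deg)

lemma e_deg_less: "degree e < degree d"
  using N e_deg by (simp add: d_deg)

lemma poly_eq: "poly (cpoly d) z * poly (cpoly b) z =
    poly (cpoly e) z * poly (cpoly a) z - of_real q0 * (poly (cpoly a) (- z))\<^sup>2"
  using arg_cong[OF eq, of "\<lambda>p. poly (cpoly p) z"] by simp

text \<open>Both terms on the right of \<open>eq\<close> have degree at most
  \<open>2 * (N - 1)\<close>; removing the factor \<open>d\<close> of degree \<open>N\<close> leaves
  at most \<open>N - 2\<close>.\<close>

lemma b_deg: "b = 0 \<or> degree b < degree a"
proof (cases "b = 0")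
  case False
  have "degree d + degree b = degree (d * b)"
    using False d_nonzero by (simp add: degree_mult_eq)
  also have "\<dots> \<le> 2 * (N - 1)"
    unfolding eq
  proof (rule degree_diff_le)
    show "degree (e * a) \<le> 2 * (N - 1)"
      using degree_mult_le[of e a] e_deg a_deg by linarith
    show "degree (smult q0 ((negarg a)\<^sup>2)) \<le> 2 * (N - 1)"
      using degree_smult_le[of q0 "(negarg a)\<^sup>2"] degree_power_le[of "negarg a" 2] a_deg by simp
  qed
  finally have "degree b < N - 1" using N unfolding d_deg by linarith
  then show ?thesis by (simp add: a_deg)
qed simp

lemma err_eq:
  assumes "poly (cpoly d) z \<noteq> 0" "poly (cpoly a) z \<noteq> 0"
  shows "err z = of_real q0 * (poly (cpoly a) (- z))\<^sup>2 / (poly (cpoly d) z * poly (cpoly a) z)"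
  using assms poly_eq[of z] by (simp add: rat_fun_def field_simps)

lemma norm_err_axis:
  assumes "poly (cpoly a) (\<i> * complex_of_real w) \<noteq> 0"
  shows "cmod (err (\<i> * complex_of_real w)) = cmod (of_real q0 * rat_fun a d (\<i> * complex_of_real w))"
  unfolding err_eq[OF d_axis assms] using assms
  by (simp add: rat_fun_def norm_mult norm_divide norm_power poly_cpoly_neg_axis power2_eq_square)

lemma rhp_decay_a_d: "rhp_decay 1 (rat_fun a d)"
  by (rule rhp_decay_rat_fun[OF hurwitz_d]) (simp add: deg_a_less)

text \<open>The moduli in \<open>norm_err_axis\<close> can differ only at zeros of \<open>a\<close>
  on the axis, which form a null set.\<close>

lemma
  shows L2_finite_err: "L2_finite err"
    and L2_sq_err: "L2_sq err = q0\<^sup>2 * L2_sq (rat_fun a d)"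
proof -
  have "AE w in lborel. cmod (err (\<i> * complex_of_real w)) = cmod (of_real q0 * rat_fun a d (\<i> * complex_of_real w))"
    using AE_axis_nonroot[OF a_nonzero] by eventually_elim (rule norm_err_axis)
  moreover have "(\<lambda>w. err (\<i> * complex_of_real w)) \<in> borel_measurable borel"
    "(\<lambda>w. of_real q0 * rat_fun a d (\<i> * complex_of_real w)) \<in> borel_measurable borel"
    by measurable
  ultimately have cong: "L2_sq err = L2_sq (\<lambda>z. of_real q0 * rat_fun a d z)"
    "L2_finite err \<longleftrightarrow> L2_finite (\<lambda>z. of_real q0 * rat_fun a d z)"
    by (intro L2_sq_cong_AE; blast)+
  have "L2_finite (\<lambda>z. of_real q0 * rat_fun a d z)"
    unfolding L2_finite_def using rhp_decay_norm_sq_integrable[OF rhp_decay_cmult[OF rhp_decay_a_d]] .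
  then show "L2_finite err" by (simp only: cong(2))
  have "L2_sq (\<lambda>z. of_real q0 * rat_fun a d z) = q0\<^sup>2 * L2_sq (rat_fun a d)"
    by (simp add: L2_sq_def norm_mult power_mult_distrib)
  then show "L2_sq err = q0\<^sup>2 * L2_sq (rat_fun a d)" by (simp only: cong(1))
qed

lemma L2_sq_err_formula:
  "complex_of_real (L2_sq err) =
    (\<Sum>\<delta>\<in>croots d. (complex_of_real q0 * poly (cpoly a) (-\<delta>)) ^ 3 /
      (poly (cpoly e) \<delta> * poly (pderiv (cpoly d)) \<delta> * poly (cpoly d) (-\<delta>)))"
proof -
  have "complex_of_real (L2_sq err) = (\<Sum>\<delta>\<in>croots d. (of_real q0)\<^sup>2 *
    (poly (cpoly a) \<delta> * poly (cpoly a) (- \<delta>) / (poly (pderiv (cpoly d)) \<delta> * poly (cpoly d) (- \<delta>))))"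
    unfolding L2_sq_err of_real_mult of_real_power
      L2_sq_rat_fun_simple_roots[OF d_monic simple_d hurwitz_d deg_a_less]
    by (rule sum_distrib_left)
  also have "\<dots> = (\<Sum>\<delta>\<in>croots d. (complex_of_real q0 * poly (cpoly a) (-\<delta>)) ^ 3 /
      (poly (cpoly e) \<delta> * poly (pderiv (cpoly d)) \<delta> * poly (cpoly d) (-\<delta>)))"
  proof (rule sum.cong[OF refl])
    fix \<delta> assume \<delta>: "\<delta> \<in> croots d"
    then have d0: "poly (cpoly d) \<delta> = 0" by (simp add: croots_def)
    have e0: "poly (cpoly e) \<delta> \<noteq> 0"
      using coprime_imp_no_common_croot[of d e \<delta>] coprime_e_d d0 by (simp add: coprime_commute)
    \<comment> \<open>At a zero of \<open>d\<close> the identity \<open>eq\<close> becomes the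
      interpolation condition. Inserting it for the value of \<open>a\<close> at
      \<open>\<delta>\<close> produces the third power.\<close>
    have "poly (cpoly a) \<delta> = of_real q0 * (poly (cpoly a) (- \<delta>))\<^sup>2 / poly (cpoly e) \<delta>"
      using poly_eq[of \<delta>] d0 e0 by (simp add: field_simps)
    then show "(of_real q0)\<^sup>2 *
      (poly (cpoly a) \<delta> * poly (cpoly a) (- \<delta>) / (poly (pderiv (cpoly d)) \<delta> * poly (cpoly d) (- \<delta>))) =
      (complex_of_real q0 * poly (cpoly a) (-\<delta>)) ^ 3 /
      (poly (cpoly e) \<delta> * poly (pderiv (cpoly d)) \<delta> * poly (cpoly d) (-\<delta>))"
      by (simp add: power2_eq_square power3_eq_cube mult_ac)
  qed
  finally show ?thesis .
qed

text \<open>The representing fraction comes from \<open>err_eq\<close>: degree at most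
  \<open>2 * N - 2\<close> over degree \<open>2 * N - 1\<close>. Only zeros of \<open>d\<close> and
  \<open>a\<close> can be exceptional points.\<close>

lemma err_in_H2:
  assumes "hurwitz a"
  shows "in_H2 err"
  unfolding in_H2_def
proof (intro exI conjI)
  show "d * a \<noteq> 0" using d_nonzero a_nonzero by simp
  show "hurwitz (d * a)" using hurwitz_d assms by (rule hurwitz_mult)
  show "degree (smult q0 ((negarg a)\<^sup>2)) < degree (d * a)"
    using degree_smult_le[of q0 "(negarg a)\<^sup>2"] degree_power_le[of "negarg a" 2] a_deg d_deg N
      d_nonzero a_nonzero by (simp add: degree_mult_eq)
  have "{z. err z \<noteq> rat_fun (smult q0 ((negarg a)\<^sup>2)) (d * a) z} \<subseteq> croots d \<union> croots a"
  proof (rule subsetI, rule ccontr)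
    fix z assume z: "z \<in> {z. err z \<noteq> rat_fun (smult q0 ((negarg a)\<^sup>2)) (d * a) z}"
      and "z \<notin> croots d \<union> croots a"
    then have "err z = of_real q0 * (poly (cpoly a) (- z))\<^sup>2 / (poly (cpoly d) z * poly (cpoly a) z)"
      by (intro err_eq) (auto simp: croots_def)
    then show False using z by (simp add: rat_fun_def)
  qed
  then show "finite {z. err z \<noteq> rat_fun (smult q0 ((negarg a)\<^sup>2)) (d * a) z}"
    using finite_croots d_nonzero a_nonzero by (meson finite_UnI finite_subset)
qed

lemma norm_err_le:
  assumes "hurwitz a" "0 \<le> Re s"
  shows "cmod (err s) \<le> \<bar>q0\<bar> * cmod (rat_fun a d s)"
proof -
  have nz: "poly (cpoly d) s \<noteq> 0" "poly (cpoly a) s \<noteq> 0"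
    using hurwitz_nonzero hurwitz_d assms by auto
  have "cmod (err s) = \<bar>q0\<bar> * (cmod (poly (cpoly a) (- s)))\<^sup>2 / (cmod (poly (cpoly d) s) * cmod (poly (cpoly a) s))"
    unfolding err_eq[OF nz] by (simp add: norm_mult norm_divide norm_power)
  also have "\<dots> \<le> \<bar>q0\<bar> * (cmod (poly (cpoly a) s))\<^sup>2 / (cmod (poly (cpoly d) s) * cmod (poly (cpoly a) s))"
    using hurwitz_reflection_bound[OF assms]
    by (intro divide_right_mono mult_left_mono power_mono) auto
  also have "\<dots> = \<bar>q0\<bar> * cmod (rat_fun a d s)"
    using nz by (simp add: rat_fun_def norm_divide power2_eq_square)
  finally show ?thesis .
qed

text \<open>Each vertical line gives at most the axis value, by comparison with \<open>q0\<close>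
  times \<open>a / d\<close>, which has the same norm as \<open>err\<close> on the axis. Lines
  approaching the axis attain this value in the limit.\<close>

lemma H2_sq_err:
  assumes a: "hurwitz a"
  shows "H2_sq err = L2_sq err"
proof -
  define J where "J \<sigma> = (\<integral>w. (cmod (err (complex_of_real \<sigma> + \<i> * complex_of_real w)))\<^sup>2 \<partial>lborel) / (2 * pi)" for \<sigma> :: real
  note d = d_monic simple_d hurwitz_d deg_a_less
  obtain g where g: "integrable lborel g"
    "\<And>\<sigma> w. 0 \<le> \<sigma> \<Longrightarrow> (cmod (rat_fun a d (of_real \<sigma> + \<i> * complex_of_real w)))\<^sup>2 \<le> g w"
    using rat_fun_shift_dominated[OF d] by blast
  have sq: "(cmod (err (of_real \<sigma> + \<i> * complex_of_real w)))\<^sup>2 \<le>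
      q0\<^sup>2 * (cmod (rat_fun a d (of_real \<sigma> + \<i> * complex_of_real w)))\<^sup>2" if "0 \<le> \<sigma>" for \<sigma> w
    using power_mono[OF norm_err_le[OF a, of "of_real \<sigma> + \<i> * complex_of_real w"], of 2] that
    by (simp add: power_mult_distrib)
  have dom: "(cmod (err (of_real \<sigma> + \<i> * complex_of_real w)))\<^sup>2 \<le> q0\<^sup>2 * g w" if "0 \<le> \<sigma>" for \<sigma> w
    using order_trans[OF sq[OF that] mult_left_mono[OF g(2)[OF that]]] by simp
  have int_ad: "integrable lborel (\<lambda>w. (cmod (rat_fun a d (of_real \<sigma> + \<i> * complex_of_real w)))\<^sup>2)"
    if "0 \<le> \<sigma>" for \<sigma>
    by (rule Bochner_Integration.integrable_bound[OF g(1)])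
       (measurable, use g(2)[OF that] in \<open>auto intro!: AE_I2 order_trans[OF _ abs_ge_self]\<close>)
  have int_g: "integrable lborel (\<lambda>w. q0\<^sup>2 * g w)" using g(1) by simp
  have int_err: "integrable lborel (\<lambda>w. (cmod (err (of_real \<sigma> + \<i> * complex_of_real w)))\<^sup>2)"
    if "0 \<le> \<sigma>" for \<sigma>
    by (rule Bochner_Integration.integrable_bound[OF int_g])
       (measurable, use dom[OF that] in \<open>auto intro!: AE_I2 order_trans[OF _ abs_ge_self]\<close>)
  have up: "J \<sigma> \<le> L2_sq err" if \<sigma>: "0 \<le> \<sigma>" for \<sigma>
  proof -
    have "(\<integral>w. (cmod (err (of_real \<sigma> + \<i> * complex_of_real w)))\<^sup>2 \<partial>lborel) \<le>
        (\<integral>w. q0\<^sup>2 * (cmod (rat_fun a d (of_real \<sigma> + \<i> * complex_of_real w)))\<^sup>2 \<partial>lborel)"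
      using int_ad[OF \<sigma>] by (intro integral_mono int_err[OF \<sigma>] sq[OF \<sigma>]) simp
    also have "\<dots> \<le> q0\<^sup>2 * (\<integral>w. (cmod (rat_fun a d (\<i> * complex_of_real w)))\<^sup>2 \<partial>lborel)"
      using mult_left_mono[OF rat_fun_shift_L2_le[OF d \<sigma>], of "q0\<^sup>2"] by simp
    finally show ?thesis
      unfolding J_def L2_sq_err L2_sq_def by (simp add: divide_right_mono)
  qed
  have "rhp_decay 1 err"
    using rhp_decay_diff[OF rhp_decay_rat_fun[OF hurwitz_d] rhp_decay_rat_fun[OF a]] e_deg_less b_deg by blast
  note cont = rhp_decay_continuous[OF this]
  \<comment> \<open>Dominated convergence along \<open>\<sigma> = 1 / (n + 1)\<close>;
    \<open>err\<close> is continuous up to the axis because \<open>a\<close> and \<open>d\<close>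
    are Hurwitz.\<close>
  have lim: "(\<lambda>n. J (inverse (real (Suc n)))) \<longlonglongrightarrow> L2_sq err"
    unfolding J_def L2_sq_def
  proof (intro tendsto_divide tendsto_const integral_dominated_convergence[OF _ _ int_g])
    show "AE w in lborel. (\<lambda>n. (cmod (err (of_real (inverse (real (Suc n))) + \<i> * complex_of_real w)))\<^sup>2)
        \<longlonglongrightarrow> (cmod (err (\<i> * complex_of_real w)))\<^sup>2"
    proof (intro AE_I2 tendsto_power tendsto_norm continuous_on_tendsto_compose[OF cont])
      fix w
      have "(\<lambda>n. complex_of_real (inverse (real (Suc n)))) \<longlonglongrightarrow> of_real 0"
        by (intro tendsto_of_real LIMSEQ_inverse_real_of_nat)
      from tendsto_add[OF this tendsto_const[of "\<i> * complex_of_real w"]]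
      show "(\<lambda>n. of_real (inverse (real (Suc n))) + \<i> * complex_of_real w) \<longlonglongrightarrow> \<i> * complex_of_real w"
        by simp
    qed auto
    show "AE w in lborel. norm ((cmod (err (of_real (inverse (real (Suc n))) + \<i> * complex_of_real w)))\<^sup>2) \<le> q0\<^sup>2 * g w" for n
      using dom[of "inverse (real (Suc n))"] by (intro AE_I2) simp
  qed (use borel_measurable_integrable[OF int_err[of 0]] borel_measurable_integrable[OF int_err] in auto)
  have bdd: "bdd_above (J ` {0<..})" using up by (intro bdd_aboveI2[where M = "L2_sq err"]) auto
  have "(SUP \<sigma>\<in>{0<..}. J \<sigma>) = L2_sq err"
  proof (rule antisym)
    show "(SUP \<sigma>\<in>{0<..}. J \<sigma>) \<le> L2_sq err" using up by (intro cSUP_least) auto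
    show "L2_sq err \<le> (SUP \<sigma>\<in>{0<..}. J \<sigma>)"
      by (rule LIMSEQ_le_const2[OF lim]) (use bdd in \<open>auto intro!: exI[of _ 0] cSUP_upper\<close>)
  qed
  then show ?thesis by (simp add: H2_sq_def J_def)
qed

end

section \<open>Improving approximants of lower order\<close>

lemma rat_fun_mult_cancel:
  "poly (cpoly r) s \<noteq> 0 \<Longrightarrow> rat_fun (p * r) (q * r) s = rat_fun p q s"
  by (simp add: rat_fun_def)

lemma add_divide_cross:
  fixes x y u v :: "'a :: field"
  assumes "x \<noteq> 0" "y \<noteq> 0"
  shows "(u * y + v * x) / (x * y) = u / x + v * (1 / y)"
  using assms by (simp add: add_divide_distrib)

lemma rat_fun_of_real: "rat_fun p q (of_real x) = of_real (poly p x / poly q x)"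
  by (simp add: rat_fun_def poly_cpoly_of_real)

lemma inner_product_real_pole:
  fixes f :: "complex \<Rightarrow> complex"
  assumes "rhp_decay 1 f" "0 < l"
  shows "(\<integral>w. f (\<i> * complex_of_real w) * cnj (rat_fun 1 [:l, 1:] (\<i> * complex_of_real w)) \<partial>lborel) =
    2 * pi * f (of_real l)"
  using rhp_reproducing_kernel[OF assms(1), of "of_real l"] assms(2) by (simp add: rat_fun_def)

text \<open>\<open>1 / (s + l)\<close> represents evaluation at \<open>l\<close>, so its squared
  norm is its own value there.\<close>

lemma L2_sq_real_pole:
  assumes "0 < l"
  shows "L2_sq (rat_fun 1 [:l, 1:]) = 1 / (2 * l)"
proof -
  have "rhp_decay 1 (rat_fun 1 [:l, 1:])"
    using assms by (intro rhp_decay_rat_fun hurwitz_linear) auto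
  from inner_product_real_pole[OF this assms]
  have "complex_of_real (\<integral>w. (cmod (rat_fun 1 [:l, 1:] (\<i> * complex_of_real w)))\<^sup>2 \<partial>lborel) = complex_of_real (2 * pi * (1 / (2 * l)))"
    unfolding integral_norm_sq_eq rat_fun_of_real by simp
  then show ?thesis unfolding L2_sq_def of_real_eq_iff by simp
qed

text \<open>A small constant \<open>t\<close> is added to \<open>B\<close>. The squared norm is
  quadratic in \<open>t\<close>, hence continuous, and only finitely many \<open>t\<close> create a
  zero common with \<open>A\<close>.\<close>

lemma perturb_to_coprime:
  assumes f: "rhp_decay 1 f" and A: "hurwitz A" "lead_coeff A = 1" "degree A = n"
    and n: "0 < n" and B: "degree B < n"
    and less: "L2_sq (\<lambda>s. f s - rat_fun B A s) < c"
  obtains B' where "(B', A) \<in> SigmaS n" "L2_sq (\<lambda>s. f s - rat_fun B' A s) < c"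
proof -
  define F where "F = (\<lambda>s. f s - rat_fun B A s)"
  have F: "rhp_decay 1 F"
    unfolding F_def using A B by (intro rhp_decay_diff f rhp_decay_rat_fun) auto
  have G: "rhp_decay 1 (rat_fun 1 A)"
    using A n by (intro rhp_decay_rat_fun) auto
  define y where "y = Re (\<integral>w. F (\<i> * complex_of_real w) * cnj (rat_fun 1 A (\<i> * complex_of_real w)) \<partial>lborel) / (2 * pi)"
  have "((\<lambda>t. L2_sq F - 2 * t * y + t\<^sup>2 * L2_sq (rat_fun 1 A)) \<longlongrightarrow>
      L2_sq F - 2 * 0 * y + 0\<^sup>2 * L2_sq (rat_fun 1 A)) (at_right 0)"
    by (intro tendsto_intros)
  then have "((\<lambda>t. L2_sq (\<lambda>s. F s - of_real t * rat_fun 1 A s)) \<longlongrightarrow> L2_sq F) (at_right 0)"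
    unfolding L2_sq_diff_scaled[OF F G] y_def[symmetric] by simp
  then have "\<forall>\<^sub>F t in at_right 0. L2_sq (\<lambda>s. F s - of_real t * rat_fun 1 A s) < c"
    using less unfolding F_def[symmetric] by (rule order_tendstoD(2))
  moreover have "finite {t. \<exists>z\<in>croots A. poly (cpoly B) z + complex_of_real t = 0}" (is "finite ?T")
  proof (rule finite_subset)
    \<comment> \<open>A zero \<open>z\<close> of \<open>A\<close> determines the only real
      \<open>t\<close> that can fail there, namely minus the real part of the value of
      \<open>B\<close>.\<close>
    show "?T \<subseteq> (\<lambda>z. - Re (poly (cpoly B) z)) ` croots A"
      by (auto simp: complex_eq_iff image_iff) (metis add.commute add_eq_0_iff)
    show "finite ((\<lambda>z. - Re (poly (cpoly B) z)) ` croots A)"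
      using A(1) by (intro finite_imageI finite_croots hurwitz_imp_nonzero)
  qed
  then have "\<forall>\<^sub>F t in at 0. t \<notin> ?T"
    using islimpt_finite islimpt_iff_eventually by blast
  then have "\<forall>\<^sub>F t in at_right 0. t \<notin> ?T"
    by (rule filter_leD[OF at_le[OF subset_UNIV]])
  ultimately have "\<forall>\<^sub>F t in at_right 0. L2_sq (\<lambda>s. F s - of_real t * rat_fun 1 A s) < c \<and> t \<notin> ?T"
    by (rule eventually_conj)
  then obtain t where t: "L2_sq (\<lambda>s. F s - of_real t * rat_fun 1 A s) < c" "t \<notin> ?T"
    using eventually_happens'[OF trivial_limit_at_right_real] by blast
  show ?thesis
  proof
    have "coprime A (B + [:t:])"
      using t(2) A(1) by (intro no_common_croot_imp_coprime hurwitz_imp_nonzero) (auto simp: croots_def)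
    moreover have "degree (B + [:t:]) < n" using B n by (intro degree_add_less) auto
    ultimately show "(B + [:t:], A) \<in> SigmaS n"
      using A by (simp add: SigmaS_def)
    have "(\<lambda>s. f s - rat_fun (B + [:t:]) A s) = (\<lambda>s. F s - of_real t * rat_fun 1 A s)"
      by (simp add: F_def rat_fun_def add_divide_distrib fun_eq_iff)
    then show "L2_sq (\<lambda>s. f s - rat_fun (B + [:t:]) A s) < c" using t(1) by simp
  qed
qed

text \<open>The gap of 2 in the degrees leaves room for one more real pole within order
  \<open>N - 1\<close>, and a suitable multiple of that pole strictly lowers the norm.\<close>

lemma lower_order_not_optimal:
  assumes d: "hurwitz d" "degree d = N" and e: "degree e < N" "coprime e d"
    and as: "hurwitz as" "lead_coeff as = 1" "degree as + 2 \<le> N"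
    and bs: "bs = 0 \<or> degree bs < degree as"
  obtains h where "h \<in> SigmaS (N - 1)"
    "L2_sq (\<lambda>s. rat_fun e d s - rat_fun (fst h) (snd h) s) < L2_sq (\<lambda>s. rat_fun e d s - rat_fun bs as s)"
proof -
  define E where "E = (\<lambda>s. rat_fun e d s - rat_fun bs as s)"
  have ed: "rhp_decay 1 (rat_fun e d)" using d e by (intro rhp_decay_rat_fun) auto
  have E: "rhp_decay 1 E"
    unfolding E_def using as bs by (intro rhp_decay_diff ed rhp_decay_rat_fun) auto
  \<comment> \<open>Otherwise \<open>d\<close>, being coprime to \<open>e\<close>, would divide
    \<open>as\<close>, whose degree is smaller. Hence the error vanishes at only finitely many
    positive reals.\<close>
  have "e * as - bs * d \<noteq> 0"
  proof
    assume "e * as - bs * d = 0"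
    then have "d dvd e * as" by simp
    then have "d dvd as" using e(2) by (simp add: coprime_dvd_mult_right_iff coprime_commute)
    then have "degree d \<le> degree as" using as(1) by (intro dvd_imp_degree_le hurwitz_imp_nonzero)
    then show False using d(2) as(3) by simp
  qed
  then have "finite {x. poly (e * as - bs * d) x = 0}" by (rule poly_roots_finite)
  then obtain l :: real where l: "0 < l" "poly (e * as - bs * d) l \<noteq> 0"
    using infinite_Ioi[of "0::real"] by (metis (mono_tags, lifting) finite_subset greaterThan_iff mem_Collect_eq subsetI)
  have nzr: "poly q l \<noteq> 0" if "hurwitz q" for q
    using hurwitz_nonzero[OF that, of "of_real l"] l(1) by (simp add: poly_cpoly_of_real)
  define v where "v = poly e l / poly d l - poly bs l / poly as l"
  have v: "v \<noteq> 0" using l(2) nzr[OF d(1)] nzr[OF as(1)] by (auto simp: v_def field_simps)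
  have Ev: "E (of_real l) = of_real v" by (simp add: E_def v_def rat_fun_of_real)
  \<comment> \<open>The minimiser of \<open>- 2 * c * v + c\<^sup>2 / (2 * l)\<close>, the change of
    the squared norm.\<close>
  define c where "c = 2 * l * v"
  have pole: "rhp_decay 1 (rat_fun 1 [:l, 1:])"
    using l(1) by (intro rhp_decay_rat_fun hurwitz_linear) auto
  have "L2_sq (\<lambda>s. E s - of_real c * rat_fun 1 [:l, 1:] s) = L2_sq E - 2 * c * v + c\<^sup>2 / (2 * l)"
    unfolding L2_sq_diff_scaled[OF E pole] inner_product_real_pole[OF E l(1)] Ev L2_sq_real_pole[OF l(1)]
    by simp
  also have "\<dots> = L2_sq E - 2 * l * v\<^sup>2"
    using l(1) by (simp add: c_def power2_eq_square)
  also have "\<dots> < L2_sq E" using l(1) v by simp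
  finally have less: "L2_sq (\<lambda>s. E s - of_real c * rat_fun 1 [:l, 1:] s) < L2_sq E" .
  \<comment> \<open>\<open>as\<close> and the new pole account for degree
    \<open>degree as + 1\<close>; \<open>k\<close> factors \<open>s + 1\<close>, cancelling in the
    fraction, raise the denominator to degree exactly \<open>N - 1\<close>.\<close>
  define k where "k = N - 2 - degree as"
  define A where "A = as * [:l, 1:] * [:1, 1:] ^ k"
  define B where "B = (bs * [:l, 1:] + smult c as) * [:1, 1:] ^ k"
  have A: "hurwitz A" "lead_coeff A = 1" "degree A = N - 1"
  proof -
    show "hurwitz A" unfolding A_def using as l(1) by (intro hurwitz_mult hurwitz_power hurwitz_linear) auto
    show "lead_coeff A = 1" unfolding A_def lead_coeff_mult lead_coeff_power as(2) by simp
    have "degree A = degree as + 1 + k"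
      unfolding A_def using hurwitz_imp_nonzero[OF as(1)] 
      by (simp add: degree_mult_eq degree_power_eq del: mult_pCons_left mult_pCons_right)
    then show "degree A = N - 1" using as(3) by (simp add: k_def)
  qed
  have "degree (bs * [:l, 1:] + smult c as) \<le> degree as"
    using bs degree_mult_le[of bs "[:l, 1:]"] by (intro degree_add_le) auto
  then have "degree B \<le> degree as + k"
    unfolding B_def using degree_mult_le[of "bs * [:l, 1:] + smult c as" "[:1, 1:] ^ k"]
      degree_power_le[of "[:1, 1:] :: real poly" k] by simp
  then have B: "degree B < N - 1" using as(3) by (simp add: k_def)
  \<comment> \<open>Restricted to the closed right half plane, where the cancelled factors have no
    zeros; the norm only needs the axis.\<close>
  have "rat_fun e d s - rat_fun B A s = E s - of_real c * rat_fun 1 [:l, 1:] s" if "0 \<le> Re s" for s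
  proof -
    have nz: "poly (cpoly as) s \<noteq> 0" "poly (cpoly ([:1, 1:] ^ k)) s \<noteq> 0" "poly (cpoly [:l, 1:]) s \<noteq> 0"
      by (rule hurwitz_nonzero[OF _ that]; use l(1) as(1) in \<open>simp add: hurwitz_power hurwitz_linear del: cpoly_pCons\<close>)+
    have "rat_fun B A s = rat_fun (bs * [:l, 1:] + smult c as) (as * [:l, 1:]) s"
      unfolding A_def B_def using nz by (intro rat_fun_mult_cancel)
    also have "\<dots> = rat_fun bs as s + of_real c * rat_fun 1 [:l, 1:] s"
      unfolding rat_fun_def cpoly_add cpoly_mult cpoly_smult cpoly_1 poly_add poly_mult poly_smult poly_1
      by (rule add_divide_cross[OF nz(1,3)])
    finally show ?thesis by (simp add: E_def)
  qed
  then have "L2_sq (\<lambda>s. rat_fun e d s - rat_fun B A s) = L2_sq (\<lambda>s. E s - of_real c * rat_fun 1 [:l, 1:] s)"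
    by (intro L2_sq_axis_cong) simp
  with less have "L2_sq (\<lambda>s. rat_fun e d s - rat_fun B A s) < L2_sq E" by simp
  with perturb_to_coprime[OF ed A _ B] as(3) obtain B' where
    "(B', A) \<in> SigmaS (N - 1)" "L2_sq (\<lambda>s. rat_fun e d s - rat_fun B' A s) < L2_sq E" by force
  then show ?thesis using that[of "(B', A)"] by (simp add: E_def)
qed

context interpolation_data
begin

text \<open>On the axis \<open>\<bar>a (-s)\<bar> = \<bar>a s\<bar>\<close>, hence \<open>\<bar>d b\<bar> \<le> \<bar>a\<bar> (\<bar>e\<bar> + \<bar>q\<^sub>0 a\<bar>)\<close>: imaginary zeros of \<open>a\<close> cancel in \<open>b / a\<close>.\<close>

lemma reduced_denominator_axis:
  assumes g: "a = a1 * g" "b = b1 * g" "coprime a1 b1"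
  shows "poly (cpoly a1) (\<i> * complex_of_real w) \<noteq> 0"
proof
  assume zero: "poly (cpoly a1) (\<i> * complex_of_real w) = 0"
  have g0: "g \<noteq> 0" using a_nonzero g by auto
  let ?p = "\<lambda>q t. poly (cpoly q) (\<i> * complex_of_real t)"
  have cont: "((\<lambda>t. ?p q t) \<longlongrightarrow> ?p q w) (at w)" for q
    by (intro tendsto_intros)
  \<comment> \<open>Near \<open>w\<close> the common factor \<open>g\<close> is nonzero and can be
    divided out; the inequality then extends to \<open>w\<close> by continuity, even if
    \<open>g\<close> vanishes there.\<close>
  have "\<forall>\<^sub>F t in at w. ?p g t \<noteq> 0"
    using islimpt_finite[OF finite_axis_roots[OF g0], of w] by (simp add: islimpt_iff_eventually)
  then have "\<forall>\<^sub>F t in at w. cmod (?p d t * ?p b1 t) \<le> cmod (?p a1 t) * (cmod (?p e t) + \<bar>q0\<bar> * cmod (?p a t))"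
  proof eventually_elim
    case (elim t)
    have "cmod (?p d t * ?p b1 t) * cmod (?p g t) = cmod (?p d t * ?p b t)"
      by (simp add: g norm_mult)
    also have "\<dots> \<le> cmod (?p e t * ?p a t) + cmod (of_real q0 * (poly (cpoly a) (- (\<i> * complex_of_real t)))\<^sup>2)"
      unfolding poly_eq by (rule norm_triangle_ineq4)
    also have "\<dots> = cmod (?p a t) * (cmod (?p e t) + \<bar>q0\<bar> * cmod (?p a t))"
      by (simp add: poly_cpoly_neg_axis norm_mult norm_power power2_eq_square algebra_simps)
    also have "\<dots> = cmod (?p a1 t) * (cmod (?p e t) + \<bar>q0\<bar> * cmod (?p a t)) * cmod (?p g t)"
      by (subst (1) g(1)) (simp add: norm_mult)
    finally show ?case using elim by simp
  qed
  then have "cmod (?p d w * ?p b1 w) \<le> cmod (?p a1 w) * (cmod (?p e w) + \<bar>q0\<bar> * cmod (?p a w))"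
    by (intro tendsto_le[OF _ _ _ _]) (auto intro!: tendsto_intros cont)
  then have "?p b1 w = 0" using zero d_axis by simp
  then show False using coprime_imp_no_common_croot[OF g(3) zero] by simp
qed

text \<open>Partial fractions \<open>b1 / a1 = bs / as + bu / au\<close> separate the stable part
  from the antistable one. Dropping the latter does not increase the norm, and what remains has too
  low an order to be optimal.\<close>

lemma not_hurwitz_not_optimal:
  assumes "\<not> hurwitz a"
  obtains h where "h \<in> SigmaS (N - 1)"
    "L2_sq (\<lambda>s. rat_fun e d s - rat_fun (fst h) (snd h) s) < L2_sq err"
proof -
  have "gcd a b \<noteq> 0" using a_nonzero by simp
  then obtain a1 b1 where "a = a1 * gcd a b" "b = b1 * gcd a b" "coprime a1 b1"
    using gcd_coprime_exists by blast
  then obtain g where g: "a = a1 * g" "b = b1 * g" "coprime a1 b1" by blast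
  have nz: "a1 \<noteq> 0" "g \<noteq> 0" using a_nonzero g by auto
  obtain as au where split: "a1 = as * au" "hurwitz as" "lead_coeff as = 1"
    "\<And>z. poly (cpoly au) z = 0 \<Longrightarrow> 0 \<le> Re z"
    using hurwitz_split[OF nz(1)] by blast
  have nz': "as \<noteq> 0" "au \<noteq> 0" using nz split by auto
  have deg: "degree a = degree as + degree au + degree g"
    using nz nz' by (simp add: g(1) split(1) degree_mult_eq)
  \<comment> \<open>Otherwise \<open>au\<close> and \<open>g\<close> would be constant and
    \<open>a\<close> Hurwitz.\<close>
  have "degree as < degree a"
  proof (rule ccontr)
    assume "\<not> degree as < degree a"
    then have "hurwitz au" "hurwitz g" using deg nz nz' by (auto intro: degree_0_imp_hurwitz)
    then have "hurwitz a" unfolding g(1) split(1) using split(2) by (intro hurwitz_mult)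
    with assms show False by simp
  qed
  then have as_deg: "degree as + 2 \<le> N" using a_deg by simp
  have au_pos: "0 < Re z" if "poly (cpoly au) z = 0" for z
  proof (rule ccontr)
    assume "\<not> 0 < Re z"
    then have "z = \<i> * of_real (Im z)" using split(4)[OF that] by (simp add: complex_eq_iff)
    moreover have "poly (cpoly a1) z = 0" using that by (simp add: split(1))
    ultimately show False using reduced_denominator_axis[OF g] by metis
  qed
  have "coprime as au"
    using split(2) au_pos nz' by (intro no_common_croot_imp_coprime) (force simp: hurwitz_def)+
  then obtain x y where xy: "x * as + y * au = 1"
    by (metis bezout_coefficients_fst_snd coprime_imp_gcd_eq_1)
  \<comment> \<open>Reduction modulo \<open>as\<close> makes \<open>bs / as\<close> strictly proper;
    the quotient is moved into \<open>bu\<close>.\<close>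
  define bs where "bs = (b1 * y) mod as"
  define bu where "bu = b1 * x + (b1 * y) div as * au"
  have "b1 = b1 * (x * as + y * au)" by (simp add: xy)
  also have "\<dots> = b1 * x * as + (b1 * y) * au" by (simp add: algebra_simps)
  also have "b1 * y = (b1 * y) div as * as + bs" by (simp add: bs_def)
  finally have b1: "b1 = bs * au + bu * as" by (simp add: bu_def algebra_simps)
  have bs: "bs = 0 \<or> degree bs < degree as"
    unfolding bs_def using nz' by (intro degree_mod_less)
  have b1_deg: "b1 = 0 \<or> degree b1 < degree as + degree au"
    using b_deg nz nz' deg by (cases "b1 = 0") (auto simp: g(2) degree_mult_eq)
  \<comment> \<open>The degree is read off from \<open>bu * as = b1 - bs * au\<close>, as
    \<open>b1 / a1\<close> and \<open>bs / as\<close> are strictly proper.\<close>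
  have bu: "bu = 0 \<or> degree bu < degree au"
  proof (cases "bu = 0")
    case False
    then have "degree bu + degree as = degree (b1 - bs * au)"
      using nz' by (simp add: b1 degree_mult_eq)
    moreover have "degree (b1 - bs * au) < degree as + degree au"
    proof (cases "bs = 0")
      case True
      then show ?thesis using b1_deg b1 False nz' by auto
    next
      case False
      then have "degree (bs * au) < degree as + degree au" using bs degree_mult_le[of bs au] by auto
      then show ?thesis using b1_deg by (auto intro: degree_diff_less)
    qed
    ultimately show ?thesis by simp
  qed simp
  define E where "E = (\<lambda>s. rat_fun e d s - rat_fun bs as s)"
  have E: "rhp_decay 1 E"
    unfolding E_def using hurwitz_d e_deg_less split(2) bs
    by (intro rhp_decay_diff rhp_decay_rat_fun) auto
  \<comment> \<open>Reflection carries the zeros of \<open>au\<close> into the open left half plane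
    and is conjugation on the axis, so there \<open>bu / au\<close> is the conjugate of a function
    with \<open>rhp_decay 1\<close>.\<close>
  have "hurwitz (negarg au)" using au_pos by (force simp: hurwitz_def)
  then have h: "rhp_decay 1 (rat_fun (negarg bu) (negarg au))"
    using bu by (intro rhp_decay_rat_fun) auto
  have cn: "rat_fun bu au (\<i> * complex_of_real w) = cnj (rat_fun (negarg bu) (negarg au) (\<i> * complex_of_real w))" for w
    by (simp add: rat_fun_def poly_cpoly_neg_axis)
  have "AE w in lborel. cmod (err (\<i> * complex_of_real w)) = cmod (E (\<i> * complex_of_real w) - rat_fun bu au (\<i> * complex_of_real w))"
    using AE_axis_nonroot[OF nz(2)]
  proof eventually_elim
    case (elim w)
    have "poly (cpoly a1) (\<i> * complex_of_real w) \<noteq> 0" by (rule reduced_denominator_axis[OF g])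
    then have "poly (cpoly as) (\<i> * complex_of_real w) \<noteq> 0" "poly (cpoly au) (\<i> * complex_of_real w) \<noteq> 0"
      by (simp_all add: split(1))
    from add_divide_cross[OF this]
    have "rat_fun b1 a1 (\<i> * complex_of_real w) = rat_fun bs as (\<i> * complex_of_real w) + rat_fun bu au (\<i> * complex_of_real w)"
      unfolding b1 split(1) rat_fun_def cpoly_add cpoly_mult poly_add poly_mult by simp
    then have "rat_fun b a (\<i> * complex_of_real w) = rat_fun bs as (\<i> * complex_of_real w) + rat_fun bu au (\<i> * complex_of_real w)"
      unfolding g(1,2) using rat_fun_mult_cancel[OF elim, of b1 a1] by simp
    then show ?case by (simp add: E_def diff_diff_eq)
  qed
  then have "L2_sq err = L2_sq (\<lambda>s. E s - rat_fun bu au s)"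
    unfolding E_def by (intro L2_sq_cong_AE(1)) measurable
  then have le: "L2_sq E \<le> L2_sq err"
    using L2_sq_pythagoras_le[OF E h cn] by simp
  have "degree e < N" using e_deg_less by (simp add: d_deg)
  from lower_order_not_optimal[OF hurwitz_d d_deg this coprime_e_d split(2,3) as_deg bs]
  obtain h where "h \<in> SigmaS (N - 1)"
    "L2_sq (\<lambda>s. rat_fun e d s - rat_fun (fst h) (snd h) s) < L2_sq E"
    unfolding E_def by blast
  then show ?thesis using that le by fastforce
qed

end

theorem theorem7:
  fixes N :: nat and d e a b :: "real poly" and q0 :: real
  assumes "N \<ge> 2"
    and "lead_coeff d = 1" and "degree d = N"
    and "card (croots d) = N" and "\<forall>\<delta>\<in>croots d. Re \<delta> < 0"
    and "degree e \<le> N - 1" and "coprime e d"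
    and "lead_coeff a = 1" and "degree a = N - 1"
    and "d * b = e * a - smult q0 ((negarg a)\<^sup>2)"
    and "\<forall>\<delta>\<in>croots d. poly (cpoly e) \<delta> * poly (cpoly a) \<delta> = (poly (cpoly a) (-\<delta>))\<^sup>2 * complex_of_real q0"
  shows "L2_finite (\<lambda>z. rat_fun e d z - rat_fun b a z)
     \<and> complex_of_real (L2_sq (\<lambda>z. rat_fun e d z - rat_fun b a z)) =
         (\<Sum>\<delta>\<in>croots d. (complex_of_real q0 * poly (cpoly a) (-\<delta>)) ^ 3 /
            (poly (cpoly e) \<delta> * poly (pderiv (cpoly d)) \<delta> * poly (cpoly d) (-\<delta>)))
     \<and> (hurwitz a \<longrightarrow> in_H2 (\<lambda>z. rat_fun e d z - rat_fun b a z)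
          \<and> H2_sq (\<lambda>z. rat_fun e d z - rat_fun b a z) = L2_sq (\<lambda>z. rat_fun e d z - rat_fun b a z))
     \<and> (\<not> hurwitz a \<longrightarrow>
          L2_sq (\<lambda>z. rat_fun e d z - rat_fun b a z) >
          (INF h\<in>SigmaS (N - 1). L2_sq (\<lambda>z. rat_fun e d z - rat_fun (fst h) (snd h) z)))"
proof -
  interpret interpolation_data N d e a b q0
    using assms(1-10) by unfold_locales
  have "(INF h\<in>SigmaS (N - 1). L2_sq (\<lambda>z. rat_fun e d z - rat_fun (fst h) (snd h) z)) < L2_sq err"
    if na: "\<not> hurwitz a"
  proof -
    obtain h where h: "h \<in> SigmaS (N - 1)"
      "L2_sq (\<lambda>s. rat_fun e d s - rat_fun (fst h) (snd h) s) < L2_sq err"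
      using not_hurwitz_not_optimal[OF na] by blast
    \<comment> \<open>Nonnegativity of \<open>L2_sq\<close> supplies the lower bound that makes the
      real infimum at most each of its values.\<close>
    have "(INF h\<in>SigmaS (N - 1). L2_sq (\<lambda>z. rat_fun e d z - rat_fun (fst h) (snd h) z)) \<le>
        L2_sq (\<lambda>s. rat_fun e d s - rat_fun (fst h) (snd h) s)"
      using h(1) by (intro cINF_lower bdd_belowI2[where m = 0] L2_sq_nonneg)
    also note h(2)
    finally show ?thesis .
  qed
  then show ?thesis
    using L2_finite_err L2_sq_err_formula err_in_H2 H2_sq_err by blast
qed

end
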